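(* Let $W:I\times\mathbb{R}^n\rightrightarrows\mathbb{R}^p$ be a set-valued map such that: (1) $W_\uparrow$ is outer semicontinuous on $I\times\mathbb{R}^n$; (2) for all $(t,x)\in(0,T)\times\mathbb{R}^n$, $y\in W(t,x)$, $w^*\in\mathbb{R}^p$ with $D^*W_\uparrow(t,x,y)(w^* )\neq\emptyset$, and all $(\xi^*,v^* )\in D^*W_\uparrow(t,x,y)(w^* )$: $\xi^*+\min_{(f,L)\in(\mathrm{FL})(x)}\big(\langle v^*,f\rangle+\langle w^*,L\rangle\big)=0$; (3) for all $x\in\mathbb{R}^n$: $W_\uparrow(0,x)\subset\limsup_{t\to0^+,x'\to x}W_\uparrow(t,x')$ and $W_\uparrow(T,x)\subset\limsup_{t\to T^-,x'\to x}W_\uparrow(t,x')$; (4) for all $x\in\mathbb{R}^n$, $W(T,x)=\{0\}$. Then for all $(t,x)\in I\times\mathbb{R}^n$: $V(t,x)\subset W_\uparrow(t,x)$ and $W(t,x)\subset V_\uparrow(t,x)$.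
   Context: Setting (MOC). Fix $T>0$, $I=[0,T]$, integers $n,m,p\ge 1$, and a nonempty compact $U\subset\mathbb{R}^m$. Let $f:\mathbb{R}^n\times U\to\mathbb{R}^n$ be continuous with constants $K_f,M_f>0$ such that $\|f(x_1,u)-f(x_2,u)\|\le K_f\|x_1-x_2\|$ and $\|f(x,u)\|\le M_f$ for all $x,x_1,x_2,u$. Let $L:\mathbb{R}^n\times U\to\mathbb{R}^p$ be continuous with $\|L(x,u)\|\le M_L$ and $\|L(x_1,u)-L(x_2,u)\|\le K_L\|x_1-x_2\|$. Controls $\mathcal{U}$: bounded Lebesgue measurable $u:I\to U$. $x(s;t,x,u)$ is the solution on $[t,T]$ of $\dot x=f(x,u(s))$, $x(t)=x$; $J(t,t',x,u)=\int_t^{t'}L(x(s;t,x,u),u(s))ds$; $Y(t,x)=\{J(t,T,x,u):u\in\mathcal{U}\}$. Euclidean norms/inner products throughout. $P\subset\mathbb{R}^p$ is a closed convex pointed cone containing $0$ with nonempty interior; $\mathcal{E}(S,P)=\{y\in S:(y-P)\cap S=\{y\}\}$. $V(t,x)=\mathcal{E}(\mathrm{cl}\,Y(t,x),P)$; for any set-valued $W$, $W_\uparrow(t,x)=W(t,x)+P$ (so $V_\uparrow=V+P$). $(\mathrm{FL})(x)=\mathrm{cl}\,\mathrm{co}\{(f(x,u),L(x,u)):u\in U\}$. Proximal normal cone of $S$ at $z\in S$: $N_S(z)=\{v:\exists M>0,\langle v,\bar z-z\rangle\le M\|\bar z-z\|^2\ \forall\bar z\in S\}$. Coderivative of $F$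 at $(z,y)\in\mathrm{gph}F$: $D^*F(z,y)(w^* )=\{v^*:(v^*,-w^* )\in N_{\mathrm{gph}F}(z,y)\}$; here $z=(t,x)\in\mathbb{R}^{1+n}$ and $v^*=(\xi^*,v^* )$ split accordingly. $\limsup_{z'\to z}F(z')=\{y:\exists z_k\to z,\exists y_k\to y,\ y_k\in F(z_k)\}$ (with the indicated one-sided restriction on $t$). $F$ is outer semicontinuous at $z$ if $\limsup_{z'\to z}F(z')\subset F(z)$. *)

theory Defs
  imports "HOL-Analysis.Analysis"
begin

definition controls :: "real \<Rightarrow> 'm::euclidean_space set \<Rightarrow> (real \<Rightarrow> 'm) set" where
  "controls T U = {u. (\<forall>s\<in>{0..T}. u s \<in> U) \<and> bounded (u ` {0..T})
      \<and> u \<in> borel_measurable (lebesgue_on {0..T})}"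

text \<open>phi is the (Caratheodory) solution on [t,T] of x' = f(x,u(s)), x(t) = x.\<close>
definition is_traj :: "('n::euclidean_space \<Rightarrow> 'm \<Rightarrow> 'n) \<Rightarrow> real \<Rightarrow> real \<Rightarrow> 'n
    \<Rightarrow> (real \<Rightarrow> 'm) \<Rightarrow> (real \<Rightarrow> 'n) \<Rightarrow> bool" where
  "is_traj f T t x u phi \<longleftrightarrow> phi t = x \<and>
     (\<forall>s\<in>{t..T}. ((\<lambda>r. f (phi r) (u r)) has_integral (phi s - x)) {t..s})"

definition Yset :: "('n::euclidean_space \<Rightarrow> 'm::euclidean_space \<Rightarrow> 'n)
    \<Rightarrow> ('n \<Rightarrow> 'm \<Rightarrow> 'p::euclidean_space) \<Rightarrow> 'm set \<Rightarrow> real \<Rightarrow> real \<Rightarrow> 'n \<Rightarrow> 'p set" where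
  "Yset f L U T t x = {integral {t..T} (\<lambda>s. L (phi s) (u s)) | u phi.
      u \<in> controls T U \<and> is_traj f T t x u phi}"

definition efficient :: "'p::real_vector set \<Rightarrow> 'p set \<Rightarrow> 'p set" where
  "efficient S P = {y \<in> S. ((\<lambda>q. y - q) ` P) \<inter> S = {y}}"

definition Vmap :: "('n::euclidean_space \<Rightarrow> 'm::euclidean_space \<Rightarrow> 'n)
    \<Rightarrow> ('n \<Rightarrow> 'm \<Rightarrow> 'p::euclidean_space) \<Rightarrow> 'm set \<Rightarrow> real \<Rightarrow> 'p set \<Rightarrow> real \<Rightarrow> 'n \<Rightarrow> 'p set" where
  "Vmap f L U T P t x = efficient (closure (Yset f L U T t x)) P"

definition up :: "(real \<Rightarrow> 'n \<Rightarrow> 'p::real_vector set) \<Rightarrow> 'p set \<Rightarrow> real \<Rightarrow> 'n \<Rightarrow> 'p set" where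
  "up W P t x = {w + q | w q. w \<in> W t x \<and> q \<in> P}"

definition prox_normal :: "'a::real_inner set \<Rightarrow> 'a \<Rightarrow> 'a set" where
  "prox_normal S z = {v. \<exists>M>0. \<forall>z'\<in>S. inner v (z' - z) \<le> M * (norm (z' - z))\<^sup>2}"

definition gph :: "real \<Rightarrow> (real \<Rightarrow> 'n \<Rightarrow> 'p set) \<Rightarrow> ((real \<times> 'n) \<times> 'p) set" where
  "gph T F = {((t, x), y). t \<in> {0..T} \<and> y \<in> F t x}"

definition coderiv :: "real \<Rightarrow> (real \<Rightarrow> 'n::real_inner \<Rightarrow> 'p::real_inner set)
    \<Rightarrow> real \<Rightarrow> 'n \<Rightarrow> 'p \<Rightarrow> 'p \<Rightarrow> (real \<times> 'n) set" where
  "coderiv T F t x y w = {v. (v, - w) \<in> prox_normal (gph T F) ((t, x), y)}"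

definition FL :: "('n \<Rightarrow> 'm \<Rightarrow> 'n::euclidean_space) \<Rightarrow> ('n \<Rightarrow> 'm \<Rightarrow> 'p::euclidean_space)
    \<Rightarrow> 'm set \<Rightarrow> 'n \<Rightarrow> ('n \<times> 'p) set" where
  "FL f L U x = closure (convex hull ((\<lambda>u. (f x u, L x u)) ` U))"

definition lim_sup_on :: "real set \<Rightarrow> (real \<Rightarrow> 'n::topological_space \<Rightarrow> 'p::topological_space set)
    \<Rightarrow> real \<Rightarrow> 'n \<Rightarrow> 'p set" where
  "lim_sup_on D F t x = {y. \<exists>tk xk yk. (\<forall>k. tk k \<in> D \<and> yk k \<in> F (tk k) (xk k))
      \<and> tk \<longlonglongrightarrow> t \<and> xk \<longlonglongrightarrow> x \<and> yk \<longlonglongrightarrow> y}"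

definition osc_on :: "real \<Rightarrow> (real \<Rightarrow> 'n::topological_space \<Rightarrow> 'p::topological_space set) \<Rightarrow> bool" where
  "osc_on T F \<longleftrightarrow> (\<forall>t\<in>{0..T}. \<forall>x. lim_sup_on {0..T} F t x \<subseteq> F t x)"

end

theory Submission
  imports Defs
begin

text \<open>Let \<open>G\<close> be the graph of \<open>W + P\<close>, a closed set. If \<open>p\<close> is a point of \<open>G\<close> nearest to \<open>z\<close>, then
  \<open>z - p\<close> is a proximal normal at \<open>p\<close>, and the Hamilton-Jacobi equation says that \<open>z - p\<close> makes a
  nonnegative inner product with every velocity \<open>(1, f, -L)\<close>, and a zero one for a suitable
  \<open>u \<in> U\<close> (a linear functional has the same minimum over \<open>FL\<close> and over the image of \<open>U\<close>).
  So up to an error of order \<open>h\<^sup>2\<close> the squared distance to \<open>G\<close> grows at most by the factor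
  \<open>1 + O(h)\<close> over a step of length \<open>h\<close>, backward along an arbitrary control, and forward along a
  well chosen constant control. Summing over the steps and letting \<open>h\<close> tend to 0 gives two facts.
  Backward from \<open>(T, x(T), 0)\<close>, every trajectory stays in \<open>G\<close>, hence \<open>cl Y \<subseteq> W + P\<close>.
  Forward from a point of \<open>G\<close>, some trajectory with a piecewise constant control ends arbitrarily
  close to \<open>W(T, x) + P = P\<close>, hence \<open>W \<subseteq> cl Y + P\<close>, and the efficient points of the compact set \<open>cl Y\<close>
  dominate all of it. The normals are controlled only for \<open>0 < t < T\<close>; distances in which time has
  a large weight keep the nearest points in that range.\<close>

section \<open>Pointed cones and domination\<close>

lemma convex_cone_add:
  assumes "convex P" "cone P" "p \<in> P" "q \<in> P"
  shows "p + q \<in> P"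
  using assms convex_cone[of P] by blast

text \<open>Pointedness makes \<open>P - {0}\<close> convex, so the convex hull of the unit vectors
  of \<open>P\<close> misses 0; being compact, it is strictly separated from 0 by a hyperplane.
  Scaling carries the sign from unit vectors to every nonzero \<open>q\<close>.\<close>

lemma pointed_cone_positive_functional:
  fixes P :: "'p::euclidean_space set"
  assumes cl: "closed P" and cv: "convex P" and cn: "cone P"
    and pt: "P \<inter> uminus ` P = {0}"
  obtains a where "\<And>q. q \<in> P \<Longrightarrow> q \<noteq> 0 \<Longrightarrow> inner a q > 0"
proof -
  define S where "S = P \<inter> sphere 0 1"
  have "compact S" unfolding S_def using cl by (simp add: closed_Int_compact)
  then have "compact (convex hull S)" by (rule compact_convex_hull)
  then have hull_closed: "closed (convex hull S)" by (rule compact_imp_closed)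
  have "convex (P - {0})"
  proof (rule convexI)
    fix p q and s t :: real
    assume h: "p \<in> P - {0}" "q \<in> P - {0}" "0 \<le> s" "0 \<le> t" "s + t = 1"
    have sp: "s *\<^sub>R p \<in> P" and tq: "t *\<^sub>R q \<in> P"
      using h cn by (auto simp: cone_def)
    have "s *\<^sub>R p + t *\<^sub>R q \<noteq> 0"
    proof
      assume "s *\<^sub>R p + t *\<^sub>R q = 0"
      then have eq: "s *\<^sub>R p = - (t *\<^sub>R q)" by (simp add: eq_neg_iff_add_eq_0)
      then have "s *\<^sub>R p \<in> P \<inter> uminus ` P" using sp tq by auto
      then have s0: "s *\<^sub>R p = 0" using pt by auto
      then have "t *\<^sub>R q = 0" using eq by simp
      then show False using s0 h by auto
    qed
    then show "s *\<^sub>R p + t *\<^sub>R q \<in> P - {0}"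
      using convex_cone_add[OF cv cn sp tq] by auto
  qed
  moreover have "S \<subseteq> P - {0}" unfolding S_def by auto
  ultimately have "convex hull S \<subseteq> P - {0}" by (rule hull_minimal[rotated])
  then have "0 \<notin> convex hull S" by auto
  then obtain a b where ab: "0 < b" "\<And>x. x \<in> convex hull S \<Longrightarrow> inner a x > b"
    using separating_hyperplane_closed_0[OF convex_convex_hull hull_closed] by metis
  have "inner a q > 0" if "q \<in> P" "q \<noteq> 0" for q
  proof -
    have "(1 / norm q) *\<^sub>R q \<in> S"
      unfolding S_def using that cn by (auto simp: cone_def)
    then have "inner a ((1 / norm q) *\<^sub>R q) > b" using ab(2) hull_inc by metis
    then have "inner a q / norm q > 0" using ab(1) by simp
    then show ?thesis using that by (simp add: zero_less_divide_iff)
  qed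
  then show ?thesis by (rule that)
qed

text \<open>A minimiser of the positive functional over the part of \<open>C\<close> below
  \<open>y\<close> is efficient: going down further by a nonzero \<open>r \<in> P\<close> would stay
  in that part, as \<open>P\<close> is closed under addition, and strictly lower the
  functional.\<close>

lemma compact_efficient_domination:
  fixes C P :: "'p::euclidean_space set"
  assumes "compact C" and cl: "closed P" and cv: "convex P" and cn: "cone P" and z: "0 \<in> P"
    and pt: "P \<inter> uminus ` P = {0}" and y: "y \<in> C"
  shows "\<exists>e\<in>efficient C P. \<exists>q\<in>P. y = e + q"
proof -
  obtain a where a: "\<And>q. q \<in> P \<Longrightarrow> q \<noteq> 0 \<Longrightarrow> inner a q > 0"
    using pointed_cone_positive_functional[OF cl cv cn pt] by blast
  define D where "D = (\<lambda>q. y - q) ` P \<inter> C"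
  have "closed ((\<lambda>q. y - q) ` P)"
    using closed_translation[OF closed_negations[OF cl], of y] by (simp add: image_image)
  then have "compact D" unfolding D_def using assms(1) by (simp add: closed_Int_compact)
  moreover have "D \<noteq> {}" unfolding D_def using y z by force
  moreover have "continuous_on D (inner a)" by (intro continuous_intros)
  ultimately obtain e where e: "e \<in> D" "\<And>x. x \<in> D \<Longrightarrow> inner a e \<le> inner a x"
    using continuous_attains_inf by metis
  obtain q where q: "q \<in> P" "e = y - q" and eC: "e \<in> C" using e(1) unfolding D_def by auto
  have "r = 0" if "r \<in> P" "e - r \<in> C" for r
  proof (rule ccontr)
    assume "r \<noteq> 0"
    have "e - r = y - (q + r)" using q by simp
    then have "e - r \<in> D"
      unfolding D_def using that convex_cone_add[OF cv cn q(1) that(1)] by blast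
    then have "inner a e \<le> inner a (e - r)" by (rule e(2))
    then show False using a[OF that(1) \<open>r \<noteq> 0\<close>] by (simp add: inner_diff_right)
  qed
  then have "e \<in> efficient C P"
    unfolding efficient_def using eC z by force
  then show ?thesis using q by force
qed

section \<open>Weighted nearest points\<close>

text \<open>The squared Euclidean distance after rescaling time by \<open>c\<close>, see
  \<open>wd2_eq_dist\<close>. Kept squared, it is a quadratic polynomial that expands exactly over a
  time step.\<close>

definition wd2 :: "real \<Rightarrow> (real \<times> 'a::real_inner) \<times> 'b::real_inner \<Rightarrow> (real \<times> 'a) \<times> 'b \<Rightarrow> real" where
  "wd2 c z p = (c * (fst (fst z) - fst (fst p)))\<^sup>2 + (norm (snd (fst z) - snd (fst p)))\<^sup>2
     + (norm (snd z - snd p))\<^sup>2"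

lemma wd2_nonneg: "wd2 c z p \<ge> 0"
  by (simp add: wd2_def)

lemma wd2_eq_dist: "wd2 c ((s, x), y) ((t, a), b) = (dist ((c * s, x), y) ((c * t, a), b))\<^sup>2"
  by (simp add: wd2_def dist_norm norm_Pair flip: right_diff_distrib)

lemma wd2_one: "wd2 1 z p = (dist z p)\<^sup>2"
  by (cases z; cases p) (metis wd2_eq_dist mult_1 surj_pair)

lemma wd2_mono: "0 \<le> c \<Longrightarrow> c \<le> c' \<Longrightarrow> wd2 c z p \<le> wd2 c' z p"
  unfolding wd2_def by (auto simp: power_mult_distrib intro!: mult_right_mono power_mono)

lemma wd2_less_imp_time_close:
  assumes "wd2 c z p < (c * \<delta>)\<^sup>2" "c > 0" "\<delta> > 0"
  shows "\<bar>fst (fst z) - fst (fst p)\<bar> < \<delta>"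
proof -
  have "(c * (fst (fst z) - fst (fst p)))\<^sup>2 < (c * \<delta>)\<^sup>2"
    using assms(1) unfolding wd2_def by (smt (verit) zero_le_power2)
  then have "\<bar>c * (fst (fst z) - fst (fst p))\<bar> < \<bar>c * \<delta>\<bar>"
    using abs_le_square_iff linorder_not_le by blast
  then show ?thesis using assms by (simp add: abs_mult)
qed

text \<open>Scaling time by \<open>c\<close> is an injective linear map, so it sends
  \<open>G\<close> to a closed set, where a Euclidean nearest point exists and can be pulled
  back.\<close>

lemma wd2_nearest:
  fixes G :: "((real \<times> 'a::euclidean_space) \<times> 'b::euclidean_space) set"
  assumes "closed G" "G \<noteq> {}" "c > 0"
  obtains p where "p \<in> G" "\<And>q. q \<in> G \<Longrightarrow> wd2 c z p \<le> wd2 c z q"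
proof -
  define \<Phi> :: "(real \<times> 'a) \<times> 'b \<Rightarrow> (real \<times> 'a) \<times> 'b"
    where "\<Phi> = (\<lambda>p. ((c * fst (fst p), snd (fst p)), snd p))"
  have "linear \<Phi>" unfolding \<Phi>_def by (auto intro!: linearI simp: algebra_simps)
  moreover have "inj \<Phi>"
    unfolding \<Phi>_def using assms(3) by (auto intro!: injI simp: prod_eq_iff)
  ultimately have "closed (\<Phi> ` G)" using assms(1) closed_injective_linear_image by blast
  then obtain w where w: "w \<in> \<Phi> ` G" "\<And>v. v \<in> \<Phi> ` G \<Longrightarrow> dist (\<Phi> z) w \<le> dist (\<Phi> z) v"
    using distance_attains_inf[of "\<Phi> ` G" "\<Phi> z"] assms(2) by blast
  then obtain p where p: "p \<in> G" "w = \<Phi> p" by auto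
  have eq: "wd2 c z q = (dist (\<Phi> z) (\<Phi> q))\<^sup>2" for q
    unfolding \<Phi>_def by (metis wd2_eq_dist prod.collapse)
  have "wd2 c z p \<le> wd2 c z q" if "q \<in> G" for q
    unfolding eq using w(2)[of "\<Phi> q"] that p by (auto intro!: power_mono)
  then show ?thesis using p(1) that by blast
qed

text \<open>The vector is minus half the gradient of \<open>wd2 c ((s, x), y)\<close> at its
  minimiser over \<open>G\<close>, hence the factor \<open>c\<^sup>2\<close> in the time
  component.\<close>

lemma wd2_nearest_prox_normal:
  assumes "((t, a), b) \<in> G"
    and near: "\<And>q. q \<in> G \<Longrightarrow> wd2 c ((s, x), y) ((t, a), b) \<le> wd2 c ((s, x), y) q"
  shows "((c\<^sup>2 * (s - t), x - a), y - b) \<in> prox_normal G ((t, a), b)"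
proof -
  have "inner ((c\<^sup>2 * (s - t), x - a), y - b) (q - ((t, a), b))
      \<le> (c\<^sup>2 + 1) * (norm (q - ((t, a), b)))\<^sup>2" if "q \<in> G" for q
  proof -
    obtain t' a' b' where q: "q = ((t', a'), b')" by (metis surj_pair)
    \<comment> \<open>Exact expansion about the minimiser; minimality then bounds twice the inner
      product by the second-order part.\<close>
    have "wd2 c ((s, x), y) ((t', a'), b') = wd2 c ((s, x), y) ((t, a), b)
        - 2 * (c\<^sup>2 * (s - t) * (t' - t) + inner (x - a) (a' - a) + inner (y - b) (b' - b))
        + (c\<^sup>2 * (t' - t)\<^sup>2 + (norm (a' - a))\<^sup>2 + (norm (b' - b))\<^sup>2)"
      unfolding wd2_def fst_conv snd_conv power2_norm_eq_inner
      by (simp add: power2_eq_square inner_diff_left inner_diff_right inner_commute algebra_simps)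
    then have "2 * (c\<^sup>2 * (s - t) * (t' - t) + inner (x - a) (a' - a) + inner (y - b) (b' - b))
        \<le> c\<^sup>2 * (t' - t)\<^sup>2 + (norm (a' - a))\<^sup>2 + (norm (b' - b))\<^sup>2"
      using near[OF that] q by simp
    also have "\<dots> \<le> 2 * ((c\<^sup>2 + 1) * ((t' - t)\<^sup>2 + (norm (a' - a))\<^sup>2 + (norm (b' - b))\<^sup>2))"
    proof -
      have "0 \<le> c\<^sup>2 * (norm (a' - a))\<^sup>2" "0 \<le> c\<^sup>2 * (norm (b' - b))\<^sup>2" "0 \<le> c\<^sup>2 * (t' - t)\<^sup>2" by auto
      then show ?thesis by (simp add: distrib_right distrib_left)
    qed
    finally show ?thesis
      unfolding q by (simp add: norm_Pair algebra_simps)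
  qed
  moreover have "c\<^sup>2 + 1 > 0" by (smt (verit) zero_le_power2)
  ultimately show ?thesis unfolding prox_normal_def by blast
qed

section \<open>Short-time solvability of Lipschitz equations\<close>

lemma integral_norm_le:
  fixes g :: "real \<Rightarrow> 'a::euclidean_space"
  assumes "a \<le> b" "g integrable_on {a..b}" "\<And>r. r \<in> {a..b} \<Longrightarrow> norm (g r) \<le> B"
  shows "norm (integral {a..b} g) \<le> B * (b - a)"
proof -
  have "0 \<le> B" using order_trans[OF norm_ge_zero assms(3)[of a]] assms(1) by auto
  then show ?thesis
    using has_integral_bound[of B g "integral {a..b} g" a b] assms by (auto simp: integrable_integral)
qed

text \<open>Picard iteration: since \<open>(b - a) * K \<le> 1/2\<close>, the integral operator
  contracts by 1/2 on bounded continuous functions, and Banach's theorem gives the fixed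
  point.\<close>

lemma lipschitz_ode_exists:
  fixes F :: "'a::euclidean_space \<Rightarrow> 'a"
  assumes lip: "\<And>x y. norm (F x - F y) \<le> K * norm (x - y)" and bd: "\<And>x. norm (F x) \<le> M"
    and K: "0 \<le> K" and ab: "a \<le> b" "(b - a) * K \<le> 1/2"
  obtains \<psi> where "continuous_on UNIV \<psi>"
    "\<And>s. s \<in> {a..b} \<Longrightarrow> ((\<lambda>r. F (\<psi> r)) has_integral (\<psi> s - x0)) {a..s}"
proof -
  have "K-lipschitz_on UNIV F"
    using lip K by (auto simp: lipschitz_on_def dist_norm)
  then have F_cont: "continuous_on S F" for S
    using lipschitz_on_continuous_on continuous_on_subset by blast
  \<comment> \<open>Clamping time to \<open>{a..b}\<close> lets the operator act on functions on the
    whole real line, so that the complete space of bounded continuous functions applies.\<close>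
  define cl where "cl s = max a (min s b)" for s :: real
  have cl_in: "cl s \<in> {a..b}" for s unfolding cl_def using ab by auto
  have cl_cont: "continuous_on UNIV cl" unfolding cl_def by (intro continuous_intros)
  have F_int: "(\<lambda>r. F (apply_bcontfun g r)) integrable_on {a..s}" for g s
    by (intro integrable_continuous_real continuous_on_compose2[OF F_cont[of UNIV]]) auto
  define A where "A g s = x0 + integral {a..cl s} (\<lambda>r. F (apply_bcontfun g r))" for g s
  have A_cont: "continuous_on UNIV (A g)" for g
  proof -
    have "continuous_on {a..b} (\<lambda>s. integral {a..s} (\<lambda>r. F (apply_bcontfun g r)))"
      by (rule indefinite_integral_continuous_1[OF F_int])
    then have "continuous_on UNIV (\<lambda>s. integral {a..cl s} (\<lambda>r. F (apply_bcontfun g r)))"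
      by (rule continuous_on_compose2[OF _ cl_cont]) (use cl_in in auto)
    then show ?thesis unfolding A_def[abs_def] by (intro continuous_intros)
  qed
  have M: "0 \<le> M" using bd[of 0] norm_ge_zero order_trans by blast
  have "norm (A g s) \<le> norm x0 + M * (b - a)" for g s
  proof -
    have "norm (integral {a..cl s} (\<lambda>r. F (apply_bcontfun g r))) \<le> M * (cl s - a)"
      using cl_in[of s] by (intro integral_norm_le F_int bd) auto
    also have "\<dots> \<le> M * (b - a)" using cl_in[of s] M by (intro mult_left_mono) auto
    finally show ?thesis unfolding A_def using norm_triangle_ineq order_trans by (smt (verit) )
  qed
  then have A_b: "A g \<in> bcontfun" for g using A_cont by (intro bcontfun_normI)
  have "\<exists>!g. Bcontfun (A g) = g"
  proof (rule banach_fix_type[of "1/2"])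
    show "\<forall>g h. dist (Bcontfun (A g)) (Bcontfun (A h)) \<le> 1/2 * dist g h"
    proof (intro allI dist_bound)
      fix g h :: "real \<Rightarrow>\<^sub>C 'a" and s
      have "A g s - A h s = integral {a..cl s} (\<lambda>r. F (apply_bcontfun g r) - F (apply_bcontfun h r))"
        unfolding A_def by (simp add: integral_diff F_int)
      also have "norm \<dots> \<le> K * dist g h * (cl s - a)"
      proof (rule integral_norm_le)
        fix r
        have "norm (F (apply_bcontfun g r) - F (apply_bcontfun h r))
            \<le> K * dist (apply_bcontfun g r) (apply_bcontfun h r)"
          using lip by (simp add: dist_norm)
        also have "\<dots> \<le> K * dist g h" using K dist_bounded by (intro mult_left_mono) auto
        finally show "norm (F (apply_bcontfun g r) - F (apply_bcontfun h r)) \<le> K * dist g h" .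
      qed (use cl_in[of s] F_int in \<open>auto intro: integrable_diff\<close>)
      also have "\<dots> \<le> K * dist g h * (b - a)"
        using cl_in[of s] K by (intro mult_left_mono) auto
      also have "\<dots> = ((b - a) * K) * dist g h" by simp
      also have "\<dots> \<le> 1/2 * dist g h" using ab by (intro mult_right_mono) auto
      finally show "dist (apply_bcontfun (Bcontfun (A g)) s) (apply_bcontfun (Bcontfun (A h)) s)
          \<le> 1/2 * dist g h"
        by (simp add: Bcontfun_inverse A_b dist_norm)
    qed
  qed auto
  then obtain g where "Bcontfun (A g) = g" by blast
  then have g: "apply_bcontfun g = A g" by (metis A_b Bcontfun_inverse)
  have "((\<lambda>r. F (apply_bcontfun g r)) has_integral (apply_bcontfun g s - x0)) {a..s}"
    if "s \<in> {a..b}" for s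
  proof -
    have "cl s = s" using that unfolding cl_def by auto
    then have "apply_bcontfun g s - x0 = integral {a..s} (\<lambda>r. F (apply_bcontfun g r))"
      by (subst g) (simp add: A_def)
    then show ?thesis using F_int integrable_integral by metis
  qed
  then show ?thesis using that[of "apply_bcontfun g"] by simp
qed

section \<open>Trajectories\<close>

text \<open>Continuity of \<open>g\<close> is known only for control values in \<open>U\<close>. Its
  extension by 0 outside the closed set \<open>UNIV \<times> U\<close> is Borel, so composing with
  the measurable pair of state and control is measurable; boundedness gives integrability.\<close>

lemma caratheodory_integrable:
  fixes g :: "'a::euclidean_space \<Rightarrow> 'm::euclidean_space \<Rightarrow> 'b::euclidean_space" and a b :: real
  assumes g: "continuous_on (UNIV \<times> U) (\<lambda>(x, u). g x u)" and "closed U"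
    and u: "u \<in> borel_measurable (lebesgue_on {a..b})" and uU: "\<And>r. r \<in> {a..b} \<Longrightarrow> u r \<in> U"
    and \<phi>: "continuous_on {a..b} \<phi>" and bd: "\<And>x w. w \<in> U \<Longrightarrow> norm (g x w) \<le> B"
  shows "(\<lambda>r. g (\<phi> r) (u r)) integrable_on {a..b}"
proof -
  define G where "G = (\<lambda>p. indicator (UNIV \<times> U) p *\<^sub>R (case p of (x, w) \<Rightarrow> g x w))"
  have "UNIV \<times> U \<in> sets (borel :: ('a \<times> 'm) measure)"
    using assms(2) by (intro borel_closed closed_Times) auto
  then have G: "G \<in> borel_measurable borel"
    unfolding G_def using g by (rule borel_measurable_continuous_on_indicator)
  have "\<phi> \<in> borel_measurable (lebesgue_on {a..b})"
    using \<phi> by (rule continuous_imp_measurable_on_sets_lebesgue) simp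
  then have "(\<lambda>r. (\<phi> r, u r)) \<in> borel_measurable (lebesgue_on {a..b})"
    using u by (rule borel_measurable_Pair)
  then have "(\<lambda>r. G (\<phi> r, u r)) \<in> borel_measurable (lebesgue_on {a..b})"
    using G by (rule measurable_compose)
  also have "?this \<longleftrightarrow> (\<lambda>r. g (\<phi> r) (u r)) \<in> borel_measurable (lebesgue_on {a..b})"
    using uU by (intro measurable_cong) (auto simp: G_def)
  finally show ?thesis
    by (rule measurable_bounded_by_integrable_imp_integrable[where g = "\<lambda>_. B"])
      (use bd uU in auto)
qed

locale moc =
  fixes U :: "'m::euclidean_space set"
    and f :: "'n::euclidean_space \<Rightarrow> 'm \<Rightarrow> 'n"
    and L :: "'n \<Rightarrow> 'm \<Rightarrow> 'p::euclidean_space"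
    and Kf Mf kL mL :: real
  assumes U_ne: "U \<noteq> {}" and U_compact: "compact U"
    and f_cont: "continuous_on (UNIV \<times> U) (\<lambda>(x, u). f x u)"
    and f_lip: "\<And>x1 x2 u. u \<in> U \<Longrightarrow> norm (f x1 u - f x2 u) \<le> Kf * norm (x1 - x2)"
    and f_bd: "\<And>x u. u \<in> U \<Longrightarrow> norm (f x u) \<le> Mf"
    and L_cont: "continuous_on (UNIV \<times> U) (\<lambda>(x, u). L x u)"
    and L_bd: "\<And>x u. u \<in> U \<Longrightarrow> norm (L x u) \<le> mL"
    and L_lip: "\<And>x1 x2 u. u \<in> U \<Longrightarrow> norm (L x1 u - L x2 u) \<le> kL * norm (x1 - x2)"
begin

lemma constants_nonneg: "0 \<le> Kf" "0 \<le> Mf" "0 \<le> kL" "0 \<le> mL"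
proof -
  obtain w where w: "w \<in> U" using U_ne by auto
  show "0 \<le> Mf" "0 \<le> mL" using order_trans[OF norm_ge_zero f_bd[OF w]] order_trans[OF norm_ge_zero L_bd[OF w]] by auto
  obtain b :: 'n where b: "norm b = 1" using vector_choose_size[of 1] by auto
  show "0 \<le> Kf" "0 \<le> kL"
    using order_trans[OF norm_ge_zero f_lip[OF w, of b 0]]
      order_trans[OF norm_ge_zero L_lip[OF w, of b 0]] b by auto
qed

text \<open>Unlike in \<open>is_traj\<close>, the interval is arbitrary and the control is
  constrained on it alone, so that trajectories can be restricted and prolonged.\<close>

definition traj :: "real \<Rightarrow> real \<Rightarrow> (real \<Rightarrow> 'm) \<Rightarrow> (real \<Rightarrow> 'n) \<Rightarrow> bool" where
  "traj a b u \<phi> \<longleftrightarrow> u \<in> borel_measurable (lebesgue_on {a..b}) \<and> (\<forall>r\<in>{a..b}. u r \<in> U) \<and>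
     (\<forall>s\<in>{a..b}. ((\<lambda>r. f (\<phi> r) (u r)) has_integral (\<phi> s - \<phi> a)) {a..s})"

lemma traj_control: "traj a b u \<phi> \<Longrightarrow> r \<in> {a..b} \<Longrightarrow> u r \<in> U"
  by (simp add: traj_def)

lemma traj_increment:
  assumes "traj a b u \<phi>" "a \<le> s" "s \<le> s'" "s' \<le> b"
  shows "((\<lambda>r. f (\<phi> r) (u r)) has_integral (\<phi> s' - \<phi> s)) {s..s'}"
proof -
  let ?g = "\<lambda>r. f (\<phi> r) (u r)"
  have *: "(?g has_integral (\<phi> s - \<phi> a)) {a..s}" "(?g has_integral (\<phi> s' - \<phi> a)) {a..s'}"
    using assms by (auto simp: traj_def)
  have ga: "?g integrable_on {a..s'}" using * by blast
  moreover from ga have "?g integrable_on {s..s'}"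
    by (rule integrable_subinterval_real) (use assms in auto)
  moreover have "integral {a..s} ?g + integral {s..s'} ?g = integral {a..s'} ?g"
    by (rule Henstock_Kurzweil_Integration.integral_combine[OF assms(2,3) ga])
  ultimately show ?thesis
    using *[THEN integral_unique] by (simp add: has_integral_iff algebra_simps)
qed

lemma traj_subinterval:
  assumes tr: "traj a b u \<phi>" and ab: "a \<le> a'" "b' \<le> b"
  shows "traj a' b' u \<phi>"
  unfolding traj_def
proof (intro conjI ballI)
  have "u \<in> borel_measurable (lebesgue_on {a..b})" using tr by (simp add: traj_def)
  then show "u \<in> borel_measurable (lebesgue_on {a'..b'})"
    by (rule measurable_restrict_mono) (use ab in simp)
  show "u r \<in> U" if "r \<in> {a'..b'}" for r
    using traj_control[OF tr] that ab by simp
  show "((\<lambda>r. f (\<phi> r) (u r)) has_integral (\<phi> s - \<phi> a')) {a'..s}" if "s \<in> {a'..b'}" for s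
    using traj_increment[OF tr] that ab by simp
qed

lemma traj_lipschitz:
  assumes "traj a b u \<phi>" "a \<le> s" "s \<le> s'" "s' \<le> b"
  shows "norm (\<phi> s' - \<phi> s) \<le> Mf * (s' - s)"
proof -
  note i = traj_increment[OF assms]
  then show ?thesis
    using integral_norm_le[OF assms(3), of "\<lambda>r. f (\<phi> r) (u r)" Mf] f_bd traj_control[OF assms(1)] assms
    by (auto simp: has_integral_iff)
qed

lemma traj_lipschitz_abs:
  assumes "traj a b u \<phi>" "s \<in> {a..b}" "s' \<in> {a..b}"
  shows "norm (\<phi> s' - \<phi> s) \<le> Mf * \<bar>s' - s\<bar>"
  using traj_lipschitz[OF assms(1), of s s'] traj_lipschitz[OF assms(1), of s' s] assms
  by (cases "s \<le> s'") (auto simp: norm_minus_commute)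

lemma traj_continuous:
  assumes "traj a b u \<phi>" shows "continuous_on {a..b} \<phi>"
proof -
  have "Mf-lipschitz_on {a..b} \<phi>"
    using traj_lipschitz_abs[OF assms] constants_nonneg by (auto simp: lipschitz_on_def dist_norm)
  then show ?thesis by (rule lipschitz_on_continuous_on)
qed

lemma traj_cost_integrable:
  assumes "traj a b u \<phi>" "a \<le> s" "s' \<le> b"
  shows "(\<lambda>r. L (\<phi> r) (u r)) integrable_on {s..s'}"
proof -
  note t = traj_subinterval[OF assms]
  show ?thesis
    by (rule caratheodory_integrable[OF L_cont _ _ _ traj_continuous[OF t] L_bd])
      (use t U_compact in \<open>auto simp: traj_def compact_imp_closed\<close>)
qed

definition cost :: "(real \<Rightarrow> 'm) \<Rightarrow> (real \<Rightarrow> 'n) \<Rightarrow> real \<Rightarrow> real \<Rightarrow> 'p" where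
  "cost u \<phi> s s' = integral {s..s'} (\<lambda>r. L (\<phi> r) (u r))"

lemma cost_bound:
  assumes "traj a b u \<phi>" "a \<le> s" "s \<le> s'" "s' \<le> b"
  shows "norm (cost u \<phi> s s') \<le> mL * (s' - s)"
  unfolding cost_def
  by (rule integral_norm_le[OF assms(3) traj_cost_integrable[OF assms(1,2,4)] L_bd])
    (use traj_control[OF assms(1)] assms in auto)

lemma cost_combine:
  assumes "traj a b u \<phi>" "a \<le> s" "s \<le> s'" "s' \<le> s''" "s'' \<le> b"
  shows "cost u \<phi> s s' + cost u \<phi> s' s'' = cost u \<phi> s s''"
  unfolding cost_def
  by (rule Henstock_Kurzweil_Integration.integral_combine[OF assms(3,4) traj_cost_integrable[OF assms(1,2,5)]])

section \<open>One-step distance estimate\<close>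

text \<open>The coefficient of the squared step length: the first three terms bound the squared
  increments of weighted time, state and cost, the last one comes from the drift of the state during
  the step.\<close>

definition step_const :: "real \<Rightarrow> real" where
  "step_const c = c\<^sup>2 + Mf\<^sup>2 + mL\<^sup>2 + (Kf + kL) * Mf\<^sup>2"

lemma step_const_nonneg: "0 \<le> step_const c"
  using constants_nonneg by (simp add: step_const_def)

text \<open>The sign \<open>\<sigma>\<close> selects the direction of time: \<open>r0 = s\<close>, \<open>\<sigma> = 1\<close> moves forward and
  \<open>r0 = s'\<close>, \<open>\<sigma> = -1\<close> backward. Comparing with the frozen state \<open>xp\<close> inside the integral
  makes a pointwise condition on the control values suffice, so no differentiation of the
  trajectory is needed.\<close>

lemma step_estimate:
  assumes tr: "traj a b u \<phi>" and ab: "a \<le> s" "s \<le> s'" "s' \<le> b" "s' - s \<le> 1"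
    and r0: "r0 \<in> {s..s'}" and \<sigma>: "\<sigma> = 1 \<or> \<sigma> = -1"
    and ham: "\<And>r. r \<in> {s..s'} \<Longrightarrow>
      \<sigma> * (c\<^sup>2 * (r0 - tp) + inner (\<phi> r0 - xp) (f xp (u r)) - inner (y - yp) (L xp (u r))) \<le> 0"
  shows "wd2 c ((r0 + \<sigma> * (s' - s), \<phi> r0 + \<sigma> *\<^sub>R (\<phi> s' - \<phi> s)), y - \<sigma> *\<^sub>R cost u \<phi> s s') ((tp, xp), yp)
    \<le> (1 + 3 * (Kf + kL) * (s' - s)) * wd2 c ((r0, \<phi> r0), y) ((tp, xp), yp)
      + step_const c * (s' - s)\<^sup>2"
proof -
  define h where "h = s' - s"
  define v where "v = \<phi> r0 - xp"
  define \<eta> where "\<eta> = y - yp"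
  define D where "D = wd2 c ((r0, \<phi> r0), y) ((tp, xp), yp)"
  define \<Delta>x where "\<Delta>x = \<phi> s' - \<phi> s"
  define \<Delta>y where "\<Delta>y = cost u \<phi> s s'"
  \<comment> \<open>Its integral over the step is half the cross term in the expansion of the
    squared distance.\<close>
  define I where "I r = \<sigma> * (c\<^sup>2 * (r0 - tp) + inner v (f (\<phi> r) (u r)) - inner \<eta> (L (\<phi> r) (u r)))" for r
  \<comment> \<open>Obtained from the Lipschitz errors by Cauchy-Schwarz and by Young's inequality
    \<open>am\<close>, with \<open>Mf * h\<close> bounding the drift of the state.\<close>
  define B where "B = (Kf + kL) * (3/2 * D + (Mf * h)\<^sup>2 / 2)"
  have h: "0 \<le> h" "h \<le> 1" using ab unfolding h_def by auto
  note nn = constants_nonneg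
  have D: "D = (c * (r0 - tp))\<^sup>2 + (norm v)\<^sup>2 + (norm \<eta>)\<^sup>2"
    unfolding D_def wd2_def v_def \<eta>_def by simp
  then have Dge: "(norm v)\<^sup>2 + (norm \<eta>)\<^sup>2 \<le> D" by simp
  have am: "p * q \<le> (p\<^sup>2 + q\<^sup>2) / 2" for p q :: real
    using sum_squares_bound[of p q] by simp
  have IB: "I r \<le> B" if r: "r \<in> {s..s'}" for r
  proof -
    have uU: "u r \<in> U" using traj_control[OF tr] r ab by auto
    have "norm (\<phi> r - \<phi> r0) \<le> Mf * \<bar>r - r0\<bar>"
      by (rule traj_lipschitz_abs[OF tr]) (use r r0 ab in auto)
    also have "\<dots> \<le> Mf * h" unfolding h_def using r r0 nn by (intro mult_left_mono) auto
    finally have \<phi>r: "norm (\<phi> r - xp) \<le> norm v + Mf * h"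
      unfolding v_def using norm_triangle_ineq[of "\<phi> r - \<phi> r0" "\<phi> r0 - xp"] by simp
    have fe: "norm (f (\<phi> r) (u r) - f xp (u r)) \<le> Kf * (norm v + Mf * h)"
      using f_lip[OF uU, of "\<phi> r" xp] mult_left_mono[OF \<phi>r nn(1)] by linarith
    have Le: "norm (L (\<phi> r) (u r) - L xp (u r)) \<le> kL * (norm v + Mf * h)"
      using L_lip[OF uU, of "\<phi> r" xp] mult_left_mono[OF \<phi>r nn(3)] by linarith
    have "\<bar>inner v (f (\<phi> r) (u r) - f xp (u r))\<bar> \<le> norm v * (Kf * (norm v + Mf * h))"
      using Cauchy_Schwarz_ineq2 mult_left_mono[OF fe norm_ge_zero] order_trans by blast
    moreover have "\<bar>inner \<eta> (L (\<phi> r) (u r) - L xp (u r))\<bar> \<le> norm \<eta> * (kL * (norm v + Mf * h))"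
      using Cauchy_Schwarz_ineq2 mult_left_mono[OF Le norm_ge_zero] order_trans by blast
    \<comment> \<open>Freezing the state at \<open>xp\<close> leaves a term that \<open>ham\<close>
      makes nonpositive, plus two Lipschitz errors.\<close>
    moreover have "I r = \<sigma> * (c\<^sup>2 * (r0 - tp) + inner v (f xp (u r)) - inner \<eta> (L xp (u r)))
       + \<sigma> * inner v (f (\<phi> r) (u r) - f xp (u r)) - \<sigma> * inner \<eta> (L (\<phi> r) (u r) - L xp (u r))"
      unfolding I_def by (simp add: inner_diff_right algebra_simps)
    moreover have "\<sigma> * (c\<^sup>2 * (r0 - tp) + inner v (f xp (u r)) - inner \<eta> (L xp (u r))) \<le> 0"
      using ham[OF r] unfolding v_def \<eta>_def .
    ultimately have "I r \<le> norm v * (Kf * (norm v + Mf * h)) + norm \<eta> * (kL * (norm v + Mf * h))"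
      using \<sigma> by (elim disjE) auto
    also have "\<dots> = Kf * (norm v * norm v + norm v * (Mf * h)) + kL * (norm \<eta> * norm v + norm \<eta> * (Mf * h))"
      by (simp add: algebra_simps)
    also have "\<dots> \<le> Kf * (3/2 * D + (Mf * h)\<^sup>2 / 2) + kL * (3/2 * D + (Mf * h)\<^sup>2 / 2)"
    proof -
      have e: "0 \<le> (norm \<eta>)\<^sup>2" "0 \<le> (norm v)\<^sup>2" by auto
      have n1: "norm v * norm v + norm v * (Mf * h) \<le> 3/2 * D + (Mf * h)\<^sup>2 / 2"
        using am[of "norm v" "Mf * h"] Dge e unfolding power2_eq_square[of "norm v", symmetric] by argo
      have n2: "norm \<eta> * norm v + norm \<eta> * (Mf * h) \<le> 3/2 * D + (Mf * h)\<^sup>2 / 2"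
        using am[of "norm \<eta>" "Mf * h"] am[of "norm \<eta>" "norm v"] Dge e by argo
      show ?thesis
        by (rule add_mono[OF mult_left_mono[OF n1 nn(1)] mult_left_mono[OF n2 nn(3)]])
    qed
    finally show ?thesis by (simp only: B_def distrib_right[of Kf kL])
  qed
  have fi: "((\<lambda>r. inner v (f (\<phi> r) (u r))) has_integral inner v \<Delta>x) {s..s'}"
    using has_integral_linear[OF traj_increment[OF tr ab(1-3)] bounded_linear_inner_right[of v]]
    unfolding \<Delta>x_def o_def .
  have Li: "((\<lambda>r. inner \<eta> (L (\<phi> r) (u r))) has_integral inner \<eta> \<Delta>y) {s..s'}"
    using has_integral_linear[OF integrable_integral[OF traj_cost_integrable[OF tr ab(1,3)]]
        bounded_linear_inner_right[of \<eta>]]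
    unfolding \<Delta>y_def cost_def o_def .
  have "(I has_integral \<sigma> * (c\<^sup>2 * (r0 - tp) * h + inner v \<Delta>x - inner \<eta> \<Delta>y)) {s..s'}"
    unfolding I_def[abs_def]
    using has_integral_const_real[of "c\<^sup>2 * (r0 - tp)" s s'] ab(2)
    by (intro has_integral_mult_right has_integral_diff has_integral_add fi Li)
      (simp add: h_def mult.commute)
  moreover have "((\<lambda>_. B) has_integral h * B) {s..s'}"
    using has_integral_const_real[of B s s'] ab(2) by (simp add: h_def)
  ultimately have S: "\<sigma> * (c\<^sup>2 * (r0 - tp) * h + inner v \<Delta>x - inner \<eta> \<Delta>y) \<le> h * B"
    using IB by (rule has_integral_le)
  have \<Delta>xb: "(norm \<Delta>x)\<^sup>2 \<le> (Mf * h)\<^sup>2"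
    using traj_lipschitz[OF tr ab(1-3)] unfolding \<Delta>x_def h_def by (intro power_mono) auto
  have \<Delta>yb: "(norm \<Delta>y)\<^sup>2 \<le> (mL * h)\<^sup>2"
    using cost_bound[OF tr ab(1-3)] unfolding \<Delta>y_def h_def by (intro power_mono) auto
  have \<sigma>2: "\<sigma> * \<sigma> = 1" using \<sigma> by auto
  then have \<sigma>3: "\<sigma> * (\<sigma> * q) = q" for q :: real by (metis mult.assoc mult_1)
  have "wd2 c ((r0 + \<sigma> * h, \<phi> r0 + \<sigma> *\<^sub>R \<Delta>x), y - \<sigma> *\<^sub>R \<Delta>y) ((tp, xp), yp)
    = (c * (r0 - tp) + c * (\<sigma> * h))\<^sup>2 + (norm (v + \<sigma> *\<^sub>R \<Delta>x))\<^sup>2 + (norm (\<eta> - \<sigma> *\<^sub>R \<Delta>y))\<^sup>2"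
    unfolding wd2_def v_def \<eta>_def by (simp add: algebra_simps)
  \<comment> \<open>The squared increments lose the sign because \<sigma> squares to 1; only the
    cross term keeps it.\<close>
  also have "\<dots> = D + 2 * (\<sigma> * (c\<^sup>2 * (r0 - tp) * h + inner v \<Delta>x - inner \<eta> \<Delta>y))
      + c\<^sup>2 * h\<^sup>2 + (norm \<Delta>x)\<^sup>2 + (norm \<Delta>y)\<^sup>2"
    unfolding D power2_norm_eq_inner
    by (simp add: power2_eq_square inner_add_left inner_add_right inner_diff_left inner_diff_right
        inner_commute algebra_simps \<sigma>3)
  also have "\<dots> \<le> D + 2 * (h * B) + c\<^sup>2 * h\<^sup>2 + (Mf * h)\<^sup>2 + (mL * h)\<^sup>2"
    using S \<Delta>xb \<Delta>yb by linarith
  also have "2 * (h * B) = 3 * (Kf + kL) * h * D + h * ((Kf + kL) * Mf\<^sup>2 * h\<^sup>2)"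
    unfolding B_def by (simp add: field_simps power2_eq_square)
  \<comment> \<open>Here \<open>h \<le> 1\<close> turns a cubic term into a quadratic one.\<close>
  also have "h * ((Kf + kL) * Mf\<^sup>2 * h\<^sup>2) \<le> 1 * ((Kf + kL) * Mf\<^sup>2 * h\<^sup>2)"
    using h nn by (intro mult_right_mono) auto
  finally have "wd2 c ((r0 + \<sigma> * h, \<phi> r0 + \<sigma> *\<^sub>R \<Delta>x), y - \<sigma> *\<^sub>R \<Delta>y) ((tp, xp), yp)
    \<le> (1 + 3 * (Kf + kL) * h) * D + step_const c * h\<^sup>2"
    unfolding step_const_def by (simp add: algebra_simps power_mult_distrib)
  then show ?thesis unfolding h_def \<Delta>x_def \<Delta>y_def D_def by assumption
qed

end

section \<open>Discrete Gronwall estimates\<close>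

text \<open>The order of choice matters: the final bound does not involve \<open>c\<close>, so
  \<open>c\<close> can be taken large against it, and only then \<open>N\<close>, in dependence on
  the error constant \<open>C c\<close>. The \<open>N\<close> errors sum to
  \<open>l\<^sup>2 * C c / N\<close>.\<close>

lemma gronwall_discretization:
  fixes K A \<epsilon> \<delta> l hmax :: real and C :: "real \<Rightarrow> real"
  assumes K: "0 \<le> K" and A: "0 \<le> A" and pos: "0 < \<epsilon>" "0 < \<delta>" "0 \<le> l" "0 < hmax"
    and C: "\<And>c. 0 \<le> C c"
  obtains c h and N :: nat where "1 \<le> c" "real N * h = l" "0 \<le> h" "h \<le> hmax"
    "\<And>k. k \<le> N \<Longrightarrow> (1 + 3 * K * h) ^ k * (A + real k * (C c * h\<^sup>2)) \<le> exp (3 * K * l) * (A + \<epsilon>)"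
    "exp (3 * K * l) * (A + \<epsilon>) < (c * \<delta>)\<^sup>2"
proof -
  define R where "R = exp (3 * K * l) * (A + \<epsilon>)"
  have R: "0 < R" unfolding R_def using A pos by (simp add: add_nonneg_pos)
  \<comment> \<open>Then \<open>c * \<delta> = \<delta> + (R + 1)\<close>, whose square exceeds
    \<open>R\<close>.\<close>
  define c where "c = 1 + (R + 1) / \<delta>"
  \<comment> \<open>The first bound yields \<open>h \<le> hmax\<close>, the second an accumulated
    error of at most \<epsilon>.\<close>
  obtain N :: nat where N: "real N > max (l / hmax) (l\<^sup>2 * C c / \<epsilon>)" using reals_Archimedean2 by blast
  have "0 \<le> l / hmax" using pos by simp
  then have N0: "real N > 0" using N by linarith
  define h where "h = l / N"
  have Nh: "real N * h = l" unfolding h_def using N0 by simp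
  have h0: "0 \<le> h" unfolding h_def using pos by simp
  have hm: "h \<le> hmax"
    using N N0 pos unfolding h_def by (simp add: field_simps)
  have NC: "real N * (C c * h\<^sup>2) \<le> \<epsilon>"
    using N N0 pos unfolding h_def by (simp add: field_simps power2_eq_square)
  have "(1 + 3 * K * h) ^ k * (A + real k * (C c * h\<^sup>2)) \<le> R" if k: "k \<le> N" for k
  proof -
    have "(1 + 3 * K * h) ^ k \<le> exp (3 * K * h) ^ k"
      using h0 K exp_ge_add_one_self[of "3 * K * h"] by (intro power_mono) auto
    also have "\<dots> = exp (real k * (3 * K * h))" by (simp add: exp_of_nat_mult)
    also have "real k * (3 * K * h) \<le> real N * (3 * K * h)"
      using k h0 K by (intro mult_right_mono) auto
    also have "\<dots> = 3 * K * l" using Nh by (simp add: algebra_simps)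
    finally have 1: "(1 + 3 * K * h) ^ k \<le> exp (3 * K * l)" by simp
    have "real k * (C c * h\<^sup>2) \<le> real N * (C c * h\<^sup>2)"
      using k C by (intro mult_right_mono) auto
    then have 2: "A + real k * (C c * h\<^sup>2) \<le> A + \<epsilon>" using NC by linarith
    show ?thesis unfolding R_def
      by (rule mult_mono[OF 1 2]) (use A C in auto)
  qed
  moreover have "R < (c * \<delta>)\<^sup>2"
  proof -
    have "c * \<delta> = \<delta> + (R + 1)" unfolding c_def using pos by (simp add: field_simps)
    then have "R + 1 \<le> c * \<delta>" using pos by simp
    then have "(R + 1)\<^sup>2 \<le> (c * \<delta>)\<^sup>2" using R by (intro power_mono) auto
    moreover have "R < (R + 1)\<^sup>2" using R by (simp add: power2_eq_square algebra_simps add_pos_pos)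
    ultimately show ?thesis by linarith
  qed
  moreover have "1 \<le> c" unfolding c_def using R pos by simp
  ultimately show ?thesis using that[OF _ Nh h0 hm] unfolding R_def by blast
qed

lemma gronwall_step:
  fixes A C \<alpha> d h2 :: real
  assumes "d \<le> (1 + \<alpha>) ^ k * (A + real k * (C * h2))" "0 \<le> \<alpha>" "0 \<le> C * h2"
  shows "(1 + \<alpha>) * d + C * h2 \<le> (1 + \<alpha>) ^ Suc k * (A + real (Suc k) * (C * h2))"
proof -
  have "(1 + \<alpha>) * d \<le> (1 + \<alpha>) * ((1 + \<alpha>) ^ k * (A + real k * (C * h2)))"
    using assms by (intro mult_left_mono) auto
  moreover have "1 * (C * h2) \<le> (1 + \<alpha>) ^ Suc k * (C * h2)"
    using assms by (intro mult_right_mono one_le_power) auto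
  ultimately show ?thesis by (simp add: algebra_simps)
qed

section \<open>Prolonging trajectories by a constant control\<close>

context moc
begin

text \<open>The equation with constant control \<open>w\<close> is solved from the end state
  \<open>\<phi> b\<close>, and the two pieces are glued; \<open>(b' - b) * Kf \<le> 1/2\<close> is
  what the Picard iteration asks for.\<close>

lemma traj_extend:
  assumes tr: "traj a b u \<phi>" and ab: "a \<le> b" "b \<le> b'" "(b' - b) * Kf \<le> 1/2" and w: "w \<in> U"
  obtains \<phi>' where "traj a b' (\<lambda>r. if r \<in> {a..b} then u r else w) \<phi>'" "\<And>r. r \<in> {a..b} \<Longrightarrow> \<phi>' r = \<phi> r"
proof -
  obtain \<psi> where \<psi>: "\<And>s. s \<in> {b..b'} \<Longrightarrow> ((\<lambda>r. f (\<psi> r) w) has_integral (\<psi> s - \<phi> b)) {b..s}"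
    using lipschitz_ode_exists[OF f_lip[OF w] f_bd[OF w] constants_nonneg(1) ab(2,3)] by metis
  \<comment> \<open>The equation at \<open>s = b\<close> integrates over a single point, which
    forces the initial value of \<psi>.\<close>
  have "((\<lambda>r. f (\<psi> r) w) has_integral 0) {b..b}" using has_integral_refl(2)[of _ b] by simp
  then have \<psi>b: "\<psi> b = \<phi> b" using has_integral_unique[OF \<psi>[of b]] ab by fastforce
  define u' where "u' = (\<lambda>r. if r \<in> {a..b} then u r else w)"
  define \<phi>' where "\<phi>' = (\<lambda>r. if r \<le> b then \<phi> r else \<psi> r)"
  have "u \<in> borel_measurable (lebesgue_on {a..b})" using tr by (simp add: traj_def)
  then have "u' \<in> borel_measurable lebesgue"
    unfolding u'_def using measurable_restrict_space_iff[of "{a..b}" lebesgue w borel u] by simp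
  then have "u' \<in> borel_measurable (lebesgue_on {a..b'})" by (rule measurable_restrict_space1)
  moreover have "u' r \<in> U" for r unfolding u'_def using traj_control[OF tr] w by auto
  moreover have "((\<lambda>r. f (\<phi>' r) (u' r)) has_integral (\<phi>' s - \<phi>' a)) {a..s}" if s: "s \<in> {a..b'}" for s
  proof -
    have 1: "((\<lambda>r. f (\<phi>' r) (u' r)) has_integral (\<phi> s - \<phi> a)) {a..s}" if "s \<in> {a..b}" for s
      by (rule has_integral_eq[OF _ traj_increment[OF tr]])
        (use that in \<open>auto simp: u'_def \<phi>'_def\<close>)
    \<comment> \<open>At the junction the glued control still has the value \<open>u b\<close>
      instead of \<open>w\<close>; one point does not change the integral.\<close>
    have 2: "((\<lambda>r. f (\<phi>' r) (u' r)) has_integral (\<psi> s - \<phi> b)) {b..s}" if "s \<in> {b..b'}" for s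
      by (rule has_integral_spike_finite[OF _ _ \<psi>[OF that], of "{b}"])
        (auto simp: u'_def \<phi>'_def)
    show ?thesis
    proof (cases "s \<le> b")
      case True
      then show ?thesis using 1[of s] s ab by (simp add: \<phi>'_def)
    next
      case False
      have "((\<lambda>r. f (\<phi>' r) (u' r)) has_integral ((\<phi> b - \<phi> a) + (\<psi> s - \<phi> b))) {a..s}"
        by (rule has_integral_combine[OF _ _ 1 2]) (use False s ab in auto)
      then show ?thesis using False s ab by (simp add: \<phi>'_def)
    qed
  qed
  ultimately have "traj a b' u' \<phi>'" unfolding traj_def by blast
  then show ?thesis by (intro that[of \<phi>']) (auto simp: u'_def \<phi>'_def)
qed

lemma cost_cong:
  assumes "\<And>r. r \<in> {s..s'} \<Longrightarrow> u r = u' r" "\<And>r. r \<in> {s..s'} \<Longrightarrow> \<phi> r = \<phi>' r"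
  shows "cost u \<phi> s s' = cost u' \<phi>' s s'"
  unfolding cost_def using assms by (intro integral_cong) auto

end

section \<open>Approximate invariance of the graph\<close>

text \<open>\<open>G\<close> will be the graph of \<open>up W P\<close>, with \<open>W\<close> and
  \<open>P\<close> abstracted away. A normal \<open>((xi, v), \<eta>)\<close> is paired with the
  velocity (1, f, -L): \<open>ham_ge\<close>, valid for all controls, drives backward invariance;
  \<open>ham_le\<close>, valid for one, drives forward viability.\<close>

locale moc_graph = moc U f L Kf Mf kL mL
  for U :: "'m::euclidean_space set"
    and f :: "'n::euclidean_space \<Rightarrow> 'm \<Rightarrow> 'n"
    and L :: "'n \<Rightarrow> 'm \<Rightarrow> 'p::euclidean_space"
    and Kf Mf kL mL :: real +
  fixes T :: real and G :: "((real \<times> 'n) \<times> 'p) set"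
  assumes T_pos: "0 < T" and G_closed: "closed G"
    and ham_ge: "\<And>t x y xi v \<eta> w. ((t, x), y) \<in> G \<Longrightarrow> 0 < t \<Longrightarrow> t < T \<Longrightarrow>
      ((xi, v), \<eta>) \<in> prox_normal G ((t, x), y) \<Longrightarrow> w \<in> U \<Longrightarrow>
      0 \<le> xi + inner v (f x w) - inner \<eta> (L x w)"
    and ham_le: "\<And>t x y xi v \<eta>. ((t, x), y) \<in> G \<Longrightarrow> 0 < t \<Longrightarrow> t < T \<Longrightarrow>
      ((xi, v), \<eta>) \<in> prox_normal G ((t, x), y) \<Longrightarrow>
      \<exists>w\<in>U. xi + inner v (f x w) - inner \<eta> (L x w) \<le> 0"
begin

abbreviation "K \<equiv> Kf + kL"

lemma K_nonneg: "0 \<le> K" using constants_nonneg by simp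

text \<open>A large time weight forces the nearest point to have almost the same time coordinate,
  so that it stays in the region where the normals are controlled.\<close>

lemma interior_nearest:
  assumes p: "p \<in> G" "wd2 c ((s, x), y) p < (c * \<delta>)\<^sup>2" and c: "0 < c"
    and \<delta>: "0 < \<delta>" "\<delta> \<le> s" "\<delta> \<le> T - s"
  obtains t a b where "((t, a), b) \<in> G" "0 < t" "t < T"
    "wd2 c ((s, x), y) ((t, a), b) \<le> wd2 c ((s, x), y) p"
    "((c\<^sup>2 * (s - t), x - a), y - b) \<in> prox_normal G ((t, a), b)"
proof -
  obtain q where q: "q \<in> G" "\<And>r. r \<in> G \<Longrightarrow> wd2 c ((s, x), y) q \<le> wd2 c ((s, x), y) r"
    using wd2_nearest[OF G_closed _ c] p(1) by blast
  obtain t a b where tab: "q = ((t, a), b)" by (metis surj_pair)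
  have le: "wd2 c ((s, x), y) ((t, a), b) \<le> wd2 c ((s, x), y) p" using q(2)[OF p(1)] tab by simp
  then have "\<bar>s - t\<bar> < \<delta>"
    using wd2_less_imp_time_close[of c "((s, x), y)" "((t, a), b)" \<delta>] p(2) c \<delta> by simp
  then show ?thesis
    using that[of t a b] q tab le \<delta> wd2_nearest_prox_normal[of t a b G c s x y] by auto
qed

text \<open>Backward in time the motion has the velocity -(1, f, -L), so \<open>ham_ge\<close>
  supplies the hypothesis of \<open>step_estimate\<close> with \<sigma> = -1, whatever the control.
  The nearest point is chosen anew at each step, and the weight \<open>c\<close> is lowered to 1
  only at the end.\<close>

lemma backward_invariance:
  assumes tr: "traj a b u \<phi>" and s: "0 < s1" "a \<le> s1" "s1 \<le> s0" "s0 \<le> b" "s0 < T"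
    and start: "((s0, xk), yk) \<in> G" and \<epsilon>: "0 < \<epsilon>"
  shows "\<exists>p\<in>G. wd2 1 ((s1, \<phi> s1), y0 + cost u \<phi> s1 s0) p
    \<le> exp (3 * K * (s0 - s1)) * ((norm (\<phi> s0 - xk))\<^sup>2 + (norm (y0 - yk))\<^sup>2 + \<epsilon>)"
proof -
  \<comment> \<open>All times in \<open>{s1..s0}\<close> keep this distance from 0 and from
    \<open>T\<close>.\<close>
  define \<delta> where "\<delta> = min s1 (T - s0)"
  define A where "A = (norm (\<phi> s0 - xk))\<^sup>2 + (norm (y0 - yk))\<^sup>2"
  have \<delta>: "0 < \<delta>" unfolding \<delta>_def using s by auto
  obtain c h N where c: "1 \<le> c" and Nh: "real N * h = s0 - s1" and h: "0 \<le> h" "h \<le> 1"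
    and gr: "\<And>k. k \<le> N \<Longrightarrow> (1 + 3 * K * h) ^ k * (A + real k * (step_const c * h\<^sup>2))
        \<le> exp (3 * K * (s0 - s1)) * (A + \<epsilon>)"
    and small: "exp (3 * K * (s0 - s1)) * (A + \<epsilon>) < (c * \<delta>)\<^sup>2"
    by (rule gronwall_discretization[of K A \<epsilon> \<delta> "s0 - s1" 1 step_const])
      (use K_nonneg \<epsilon> \<delta> s step_const_nonneg in \<open>auto simp: A_def\<close>)
  have *: "\<exists>p\<in>G. wd2 c ((s0 - real k * h, \<phi> (s0 - real k * h)), y0 + cost u \<phi> (s0 - real k * h) s0) p
      \<le> (1 + 3 * K * h) ^ k * (A + real k * (step_const c * h\<^sup>2))" if "k \<le> N" for k
    using that
  proof (induction k)
    case 0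
    \<comment> \<open>The starting point shares the time \<open>s0\<close>, so the initial error
      \<open>A\<close> is free of \<open>c\<close>.\<close>
    show ?case
      by (rule bexI[OF _ start]) (simp add: wd2_def A_def cost_def)
  next
    case (Suc k)
    define s' where "s' = s0 - real k * h"
    define y where "y = y0 + cost u \<phi> s' s0"
    have "real k * h \<le> real N * h" "real (Suc k) * h \<le> real N * h"
      using Suc.prems h by (auto intro!: mult_right_mono)
    then have s'b: "s1 \<le> s' - h" "s' \<le> s0"
      unfolding s'_def using Nh h by (auto simp: algebra_simps)
    obtain p where p: "p \<in> G"
        "wd2 c ((s', \<phi> s'), y) p \<le> (1 + 3 * K * h) ^ k * (A + real k * (step_const c * h\<^sup>2))"
      using Suc unfolding s'_def y_def by auto
    \<comment> \<open>This bound puts the time of the nearest point strictly between 0 and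
      \<open>T\<close>.\<close>
    then have "wd2 c ((s', \<phi> s'), y) p < (c * \<delta>)\<^sup>2"
      using gr[of k] small Suc.prems by simp
    then obtain t xq yq where q: "((t, xq), yq) \<in> G" "0 < t" "t < T"
        "wd2 c ((s', \<phi> s'), y) ((t, xq), yq) \<le> wd2 c ((s', \<phi> s'), y) p"
        "((c\<^sup>2 * (s' - t), \<phi> s' - xq), y - yq) \<in> prox_normal G ((t, xq), yq)"
      by (rule interior_nearest[OF p(1)]) (use c \<delta> s'b h in \<open>auto simp: \<delta>_def\<close>)
    have "wd2 c ((s' + - 1 * (s' - (s' - h)), \<phi> s' + - 1 *\<^sub>R (\<phi> s' - \<phi> (s' - h))),
          y - - 1 *\<^sub>R cost u \<phi> (s' - h) s') ((t, xq), yq)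
        \<le> (1 + 3 * K * (s' - (s' - h))) * wd2 c ((s', \<phi> s'), y) ((t, xq), yq)
          + step_const c * (s' - (s' - h))\<^sup>2"
    proof (rule step_estimate[OF tr])
      fix r assume "r \<in> {s' - h..s'}"
      then have "u r \<in> U" using traj_control[OF tr] s'b s by auto
      then show "- 1 * (c\<^sup>2 * (s' - t) + inner (\<phi> s' - xq) (f xq (u r)) - inner (y - yq) (L xq (u r))) \<le> 0"
        using ham_ge[OF q(1,2,3,5)] by simp
    qed (use s s'b h in auto)
    moreover have "y + cost u \<phi> (s' - h) s' = y0 + cost u \<phi> (s' - h) s0"
      unfolding y_def using cost_combine[OF tr, of "s' - h" s' s0] s s'b h by (simp add: algebra_simps)
    ultimately have "wd2 c ((s' - h, \<phi> (s' - h)), y0 + cost u \<phi> (s' - h) s0) ((t, xq), yq)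
        \<le> (1 + 3 * K * h) * wd2 c ((s', \<phi> s'), y) ((t, xq), yq) + step_const c * h\<^sup>2"
      by simp
    also have "\<dots> \<le> (1 + 3 * K * h) ^ Suc k * (A + real (Suc k) * (step_const c * h\<^sup>2))"
      by (rule gronwall_step) (use q(4) p(2) K_nonneg h step_const_nonneg in auto)
    finally have "\<exists>p\<in>G. wd2 c ((s' - h, \<phi> (s' - h)), y0 + cost u \<phi> (s' - h) s0) p
        \<le> (1 + 3 * K * h) ^ Suc k * (A + real (Suc k) * (step_const c * h\<^sup>2))"
      using q(1) by blast
    moreover have "s' - h = s0 - real (Suc k) * h" unfolding s'_def by (simp add: algebra_simps)
    ultimately show ?case by metis
  qed
  have "s0 - real N * h = s1" using Nh by simp
  then obtain p where p: "p \<in> G" "wd2 c ((s1, \<phi> s1), y0 + cost u \<phi> s1 s0) p \<le> exp (3 * K * (s0 - s1)) * (A + \<epsilon>)"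
    using *[of N] gr[of N] by force
  moreover have "wd2 1 ((s1, \<phi> s1), y0 + cost u \<phi> s1 s0) p \<le> wd2 c ((s1, \<phi> s1), y0 + cost u \<phi> s1 s0) p"
    using c by (intro wd2_mono) auto
  ultimately show ?thesis unfolding A_def by force
qed

text \<open>The control is built along the way: \<open>ham_le\<close> at the current nearest point
  supplies a value \<open>w\<close>, which is held over the next step.\<close>

lemma forward_viability:
  assumes tr: "traj a s0 u \<phi>" and s: "0 < s0" "a \<le> s0" "s0 \<le> s1" "s1 < T"
    and start: "((s0, xk), yk) \<in> G" and \<epsilon>: "0 < \<epsilon>"
  shows "\<exists>u' \<phi>'. traj a s1 u' \<phi>' \<and> (\<forall>r\<in>{a..s0}. u' r = u r \<and> \<phi>' r = \<phi> r) \<and>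
    (\<exists>p\<in>G. wd2 1 ((s1, \<phi>' s1), y0 - cost u' \<phi>' s0 s1) p
      \<le> exp (3 * K * (s1 - s0)) * ((norm (\<phi> s0 - xk))\<^sup>2 + (norm (y0 - yk))\<^sup>2 + \<epsilon>))"
proof -
  define \<delta> where "\<delta> = min s0 (T - s1)"
  define A where "A = (norm (\<phi> s0 - xk))\<^sup>2 + (norm (y0 - yk))\<^sup>2"
  have \<delta>: "0 < \<delta>" unfolding \<delta>_def using s by auto
  \<comment> \<open>The limit 1 serves \<open>step_estimate\<close>, the other one
    \<open>traj_extend\<close>.\<close>
  define hm where "hm = min 1 (1 / (2 * (Kf + 1)))"
  have hm: "0 < hm" unfolding hm_def using constants_nonneg by auto
  obtain c h N where c: "1 \<le> c" and Nh: "real N * h = s1 - s0" and h: "0 \<le> h" "h \<le> hm"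
    and gr: "\<And>k. k \<le> N \<Longrightarrow> (1 + 3 * K * h) ^ k * (A + real k * (step_const c * h\<^sup>2))
        \<le> exp (3 * K * (s1 - s0)) * (A + \<epsilon>)"
    and small: "exp (3 * K * (s1 - s0)) * (A + \<epsilon>) < (c * \<delta>)\<^sup>2"
    by (rule gronwall_discretization[of K A \<epsilon> \<delta> "s1 - s0" hm step_const])
      (use K_nonneg \<epsilon> \<delta> s step_const_nonneg hm in \<open>auto simp: A_def\<close>)
  have hKf: "h * Kf \<le> 1/2"
  proof -
    have "h * Kf \<le> (1 / (2 * (Kf + 1))) * Kf"
      using h constants_nonneg unfolding hm_def by (intro mult_right_mono) auto
    also have "\<dots> \<le> 1/2" using constants_nonneg by (simp add: field_simps)
    finally show ?thesis .
  qed
  have *: "\<exists>u' \<phi>'. traj a (s0 + real k * h) u' \<phi>' \<and> (\<forall>r\<in>{a..s0}. u' r = u r \<and> \<phi>' r = \<phi> r) \<and>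
    (\<exists>p\<in>G. wd2 c ((s0 + real k * h, \<phi>' (s0 + real k * h)), y0 - cost u' \<phi>' s0 (s0 + real k * h)) p
      \<le> (1 + 3 * K * h) ^ k * (A + real k * (step_const c * h\<^sup>2)))" if "k \<le> N" for k
    using that
  proof (induction k)
    case 0
    have "wd2 c ((s0, \<phi> s0), y0 - cost u \<phi> s0 s0) ((s0, xk), yk) \<le> A"
      by (simp add: wd2_def A_def cost_def)
    then show ?case using tr start by (intro exI[of _ u] exI[of _ \<phi>]) auto
  next
    case (Suc k)
    define s' where "s' = s0 + real k * h"
    have "real k * h \<le> real N * h" "real (Suc k) * h \<le> real N * h"
      using Suc.prems h by (auto intro!: mult_right_mono)
    then have s'b: "s' + h \<le> s1" "s0 \<le> s'"
      unfolding s'_def using Nh h by (auto simp: algebra_simps)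
    obtain u0 \<phi>0 p where tr0: "traj a s' u0 \<phi>0" and ag: "\<forall>r\<in>{a..s0}. u0 r = u r \<and> \<phi>0 r = \<phi> r"
      and p: "p \<in> G" "wd2 c ((s', \<phi>0 s'), y0 - cost u0 \<phi>0 s0 s') p
          \<le> (1 + 3 * K * h) ^ k * (A + real k * (step_const c * h\<^sup>2))"
      using Suc unfolding s'_def by auto
    define y where "y = y0 - cost u0 \<phi>0 s0 s'"
    have "wd2 c ((s', \<phi>0 s'), y) p < (c * \<delta>)\<^sup>2"
      using p(2) gr[of k] small Suc.prems unfolding y_def by simp
    then obtain t xq yq where q: "((t, xq), yq) \<in> G" "0 < t" "t < T"
        "wd2 c ((s', \<phi>0 s'), y) ((t, xq), yq) \<le> wd2 c ((s', \<phi>0 s'), y) p"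
        "((c\<^sup>2 * (s' - t), \<phi>0 s' - xq), y - yq) \<in> prox_normal G ((t, xq), yq)"
      by (rule interior_nearest[OF p(1)]) (use c \<delta> s'b h in \<open>auto simp: \<delta>_def\<close>)
    obtain w where w: "w \<in> U"
      "c\<^sup>2 * (s' - t) + inner (\<phi>0 s' - xq) (f xq w) - inner (y - yq) (L xq w) \<le> 0"
      using ham_le[OF q(1,2,3,5)] by blast
    define u' where "u' = (\<lambda>r. if r \<in> {a..s'} then u0 r else w)"
    obtain \<phi>' where tr': "traj a (s' + h) u' \<phi>'" and \<phi>': "\<And>r. r \<in> {a..s'} \<Longrightarrow> \<phi>' r = \<phi>0 r"
      unfolding u'_def using traj_extend[OF tr0 _ _ _ w(1), of "s' + h"] s s'b h hKf by auto
    have \<phi>'s: "\<phi>' s' = \<phi>0 s'" using \<phi>' s s'b by auto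
    \<comment> \<open>At the instant \<open>s'\<close> the control \<open>u'\<close> still has its
      old value, about which the choice of \<open>w\<close> says nothing. Changing this one value
      leaves all integrals as they are and makes the control equal to \<open>w\<close> on the whole
      step.\<close>
    define v where "v = (\<lambda>r. if r = s' then w else u' r)"
    have cv: "cost v \<phi>' s' (s' + h) = cost u' \<phi>' s' (s' + h)"
      unfolding cost_def by (rule integral_spike[of "{s'}"]) (auto simp: v_def)
    have trv: "traj s' (s' + h) v \<phi>'"
      unfolding traj_def
    proof (intro conjI ballI)
      have vw: "v r = w" if "r \<in> {s'..s' + h}" for r
        using that by (auto simp: v_def u'_def)
      show "v r \<in> U" if "r \<in> {s'..s' + h}" for r using vw[OF that] w by simp
      have "v \<in> borel_measurable (lebesgue_on {s'..s' + h}) \<longleftrightarrow> (\<lambda>_. w) \<in> borel_measurable (lebesgue_on {s'..s' + h})"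
        using vw by (intro measurable_cong) auto
      then show "v \<in> borel_measurable (lebesgue_on {s'..s' + h})" by simp
      show "((\<lambda>r. f (\<phi>' r) (v r)) has_integral (\<phi>' r - \<phi>' s')) {s'..r}" if "r \<in> {s'..s' + h}" for r
        by (rule has_integral_spike_finite[OF _ _ traj_increment[OF tr'], of "{s'}"])
          (use that s s'b in \<open>auto simp: v_def\<close>)
    qed
    have "wd2 c ((s' + 1 * (s' + h - s'), \<phi>' s' + 1 *\<^sub>R (\<phi>' (s' + h) - \<phi>' s')),
          y - 1 *\<^sub>R cost v \<phi>' s' (s' + h)) ((t, xq), yq)
        \<le> (1 + 3 * K * (s' + h - s')) * wd2 c ((s', \<phi>' s'), y) ((t, xq), yq)
          + step_const c * (s' + h - s')\<^sup>2"
    proof (rule step_estimate[OF trv])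
      fix r assume "r \<in> {s'..s' + h}"
      then have "v r = w" by (auto simp: v_def u'_def)
      then show "1 * (c\<^sup>2 * (s' - t) + inner (\<phi>' s' - xq) (f xq (v r)) - inner (y - yq) (L xq (v r))) \<le> 0"
        using w(2) \<phi>'s by simp
    qed (use s s'b h in \<open>auto simp: hm_def\<close>)
    moreover have "cost u' \<phi>' s0 s' = cost u0 \<phi>0 s0 s'"
      by (rule cost_cong) (use \<phi>' s in \<open>auto simp: u'_def\<close>)
    then have "y - cost v \<phi>' s' (s' + h) = y0 - cost u' \<phi>' s0 (s' + h)"
      unfolding y_def cv using cost_combine[OF tr', of s0 s' "s' + h"] s s'b h by (simp add: algebra_simps)
    ultimately have "wd2 c ((s' + h, \<phi>' (s' + h)), y0 - cost u' \<phi>' s0 (s' + h)) ((t, xq), yq)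
        \<le> (1 + 3 * K * h) * wd2 c ((s', \<phi>0 s'), y) ((t, xq), yq) + step_const c * h\<^sup>2"
      using \<phi>'s by simp
    also have "\<dots> \<le> (1 + 3 * K * h) ^ Suc k * (A + real (Suc k) * (step_const c * h\<^sup>2))"
      by (rule gronwall_step) (use q(4) p(2) K_nonneg h step_const_nonneg in \<open>auto simp: y_def\<close>)
    finally have "\<exists>p\<in>G. wd2 c ((s' + h, \<phi>' (s' + h)), y0 - cost u' \<phi>' s0 (s' + h)) p
        \<le> (1 + 3 * K * h) ^ Suc k * (A + real (Suc k) * (step_const c * h\<^sup>2))"
      using q(1) by blast
    moreover have "s' + h = s0 + real (Suc k) * h" unfolding s'_def by (simp add: algebra_simps)
    moreover have "\<forall>r\<in>{a..s0}. u' r = u r \<and> \<phi>' r = \<phi> r"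
      using ag \<phi>' s'b by (auto simp: u'_def)
    ultimately show ?case using tr' by metis
  qed
  have "s0 + real N * h = s1" using Nh by simp
  then obtain u' \<phi>' p where res: "traj a s1 u' \<phi>'" "\<forall>r\<in>{a..s0}. u' r = u r \<and> \<phi>' r = \<phi> r"
    and p: "p \<in> G" "wd2 c ((s1, \<phi>' s1), y0 - cost u' \<phi>' s0 s1) p \<le> exp (3 * K * (s1 - s0)) * (A + \<epsilon>)"
    using *[of N] gr[of N] by force
  moreover have "wd2 1 ((s1, \<phi>' s1), y0 - cost u' \<phi>' s0 s1) p \<le> wd2 c ((s1, \<phi>' s1), y0 - cost u' \<phi>' s0 s1) p"
    using c by (intro wd2_mono) auto
  ultimately show ?thesis unfolding A_def by (meson order_trans)
qed

end

section \<open>Passage to the limit\<close>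

lemma quadratic_small:
  fixes Q \<eta> e :: real
  assumes "0 \<le> Q" "0 < \<eta>" "\<eta> \<le> e / (Q + 1)"
  shows "Q * \<eta>\<^sup>2 < e\<^sup>2"
proof -
  have "(Q + 1) * \<eta> \<le> e" using assms by (simp add: field_simps)
  then have "((Q + 1) * \<eta>)\<^sup>2 \<le> e\<^sup>2" using assms by (intro power_mono) auto
  moreover have "Q * \<eta>\<^sup>2 < ((Q + 1) * \<eta>)\<^sup>2"
  proof -
    have "Q < (Q + 1)\<^sup>2" using assms mult_nonneg_nonneg[of Q Q]
      unfolding power2_eq_square distrib_left distrib_right by linarith
    then show ?thesis using assms by (simp add: power_mult_distrib)
  qed
  ultimately show ?thesis by linarith
qed

context moc_graph
begin

text \<open>\<open>backward_invariance\<close> must start before \<open>T\<close>;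
  \<open>near\<close> supplies points of \<open>G\<close> that do so and approach (T, \<phi> T, 0),
  and every error is of order \<eta>.\<close>

lemma backward_limit_interior:
  assumes tr: "traj a T u \<phi>" and s1: "0 < s1" "a \<le> s1" "s1 < T"
    and near: "\<And>e. 0 < e \<Longrightarrow> \<exists>s x y. ((s, x), y) \<in> G \<and> T - e < s \<and> s < T \<and>
      norm (x - \<phi> T) < e \<and> norm y < e"
  shows "((s1, \<phi> s1), cost u \<phi> s1 T) \<in> G"
proof -
  have "\<exists>p\<in>G. dist p ((s1, \<phi> s1), cost u \<phi> s1 T) < e" if e: "0 < e" for e
  proof -
    note nn = constants_nonneg
    \<comment> \<open>The three summands account for the state mismatch, the cost mismatch and the
      discretization error.\<close>
    define Q where "Q = exp (3 * K * T) * ((Mf + 1)\<^sup>2 + (mL + 1)\<^sup>2 + 1)"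
    have Q: "0 \<le> Q" unfolding Q_def by simp
    define \<eta> where "\<eta> = min (T - s1) (e / (Q + 1))"
    have \<eta>: "0 < \<eta>" "\<eta> \<le> T - s1" "\<eta> \<le> e / (Q + 1)" unfolding \<eta>_def using s1 e Q by auto
    obtain s0 xk yk where k: "((s0, xk), yk) \<in> G" "T - \<eta> < s0" "s0 < T"
        "norm (xk - \<phi> T) < \<eta>" "norm yk < \<eta>"
      using near[OF \<eta>(1)] by blast
    \<comment> \<open>Taking the true remaining cost reproduces the cost over \<open>{s1..T}\<close>
      exactly; only its difference from \<open>yk\<close> is an error.\<close>
    define y0 where "y0 = cost u \<phi> s0 T"
    obtain p where p: "p \<in> G" "wd2 1 ((s1, \<phi> s1), y0 + cost u \<phi> s1 s0) p
      \<le> exp (3 * K * (s0 - s1)) * ((norm (\<phi> s0 - xk))\<^sup>2 + (norm (y0 - yk))\<^sup>2 + \<eta>\<^sup>2)"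
      using backward_invariance[OF tr s1(1,2) _ _ k(3,1), of "\<eta>\<^sup>2" y0] \<eta> k by auto
    have "norm (\<phi> T - \<phi> s0) \<le> Mf * (T - s0)"
      by (rule traj_lipschitz[OF tr]) (use k s1 \<eta> in auto)
    also have "\<dots> \<le> Mf * \<eta>" using k nn by (intro mult_left_mono) auto
    finally have "norm (\<phi> s0 - xk) \<le> (Mf + 1) * \<eta>"
      using k(4) norm_triangle_ineq4[of "\<phi> s0 - \<phi> T" "xk - \<phi> T"]
      by (simp add: norm_minus_commute algebra_simps)
    then have 1: "(norm (\<phi> s0 - xk))\<^sup>2 \<le> ((Mf + 1) * \<eta>)\<^sup>2" by (intro power_mono) auto
    have "norm y0 \<le> mL * (T - s0)"
      unfolding y0_def by (rule cost_bound[OF tr]) (use k s1 \<eta> in auto)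
    also have "\<dots> \<le> mL * \<eta>" using k nn by (intro mult_left_mono) auto
    finally have "norm (y0 - yk) \<le> (mL + 1) * \<eta>"
      using k(5) norm_triangle_ineq4[of y0 yk] by (simp add: algebra_simps)
    then have 2: "(norm (y0 - yk))\<^sup>2 \<le> ((mL + 1) * \<eta>)\<^sup>2" by (intro power_mono) auto
    have "y0 + cost u \<phi> s1 s0 = cost u \<phi> s1 T"
      unfolding y0_def using cost_combine[OF tr, of s1 s0 T] k s1 \<eta> by (simp add: add.commute)
    then have "(dist ((s1, \<phi> s1), cost u \<phi> s1 T) p)\<^sup>2
        \<le> exp (3 * K * (s0 - s1)) * ((norm (\<phi> s0 - xk))\<^sup>2 + (norm (y0 - yk))\<^sup>2 + \<eta>\<^sup>2)"
      using p(2) by (simp add: wd2_one)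
    also have "\<dots> \<le> exp (3 * K * T) * (((Mf + 1) * \<eta>)\<^sup>2 + ((mL + 1) * \<eta>)\<^sup>2 + \<eta>\<^sup>2)"
      using 1 2 k s1 K_nonneg by (intro mult_mono add_mono) (auto intro!: mult_left_mono)
    also have "\<dots> = Q * \<eta>\<^sup>2" unfolding Q_def power_mult_distrib by (simp add: algebra_simps)
    also have "\<dots> < e\<^sup>2" by (rule quadratic_small[OF Q \<eta>(1,3)])
    finally have "dist ((s1, \<phi> s1), cost u \<phi> s1 T) p < e"
      using e by (simp add: power2_less_imp_less)
    then show ?thesis using p(1) by (auto simp: dist_commute)
  qed
  then show ?thesis using closed_approachable[OF G_closed] by blast
qed

text \<open>The interior version excludes \<open>a = 0\<close>, so \<open>a\<close> is approached
  from the right and closedness of \<open>G\<close> gives the limit.\<close>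

lemma backward_limit:
  assumes tr: "traj a T u \<phi>" and a: "0 \<le> a" "a < T"
    and near: "\<And>e. 0 < e \<Longrightarrow> \<exists>s x y. ((s, x), y) \<in> G \<and> T - e < s \<and> s < T \<and>
      norm (x - \<phi> T) < e \<and> norm y < e"
  shows "((a, \<phi> a), cost u \<phi> a T) \<in> G"
proof -
  \<comment> \<open>The shift by 2 keeps \<open>s n\<close> strictly below \<open>T\<close> already
    for \<open>n = 0\<close>.\<close>
  define s where "s n = a + (T - a) / real (n + 2)" for n
  have s: "a < s n" "s n < T" for n
  proof -
    have "(T - a) / real (n + 2) \<le> (T - a) / 2"
      using a by (intro divide_left_mono) auto
    moreover have "0 < (T - a) / real (n + 2)" using a by simp
    ultimately show "a < s n" "s n < T" unfolding s_def using a by (simp_all add: field_simps)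
  qed
  have "(\<lambda>n. a + (T - a) / real (n + 2)) \<longlonglongrightarrow> a + 0"
    by (intro tendsto_add tendsto_const lim_const_over_n[THEN LIMSEQ_ignore_initial_segment])
  then have lim: "s \<longlonglongrightarrow> a" unfolding s_def[abs_def] by simp
  have "continuous_on {a..T} (\<lambda>r. cost u \<phi> r T)"
    unfolding cost_def using traj_cost_integrable[OF tr, of a T]
    by (intro indefinite_integral_continuous_1') auto
  then have c: "(\<lambda>n. cost u \<phi> (s n) T) \<longlonglongrightarrow> cost u \<phi> a T"
    by (rule continuous_on_tendsto_compose[OF _ lim]) (use a s in \<open>auto intro!: always_eventually less_imp_le\<close>)
  have p: "(\<lambda>n. \<phi> (s n)) \<longlonglongrightarrow> \<phi> a"
    by (rule continuous_on_tendsto_compose[OF traj_continuous[OF tr] lim])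
      (use a s in \<open>auto intro!: always_eventually less_imp_le\<close>)
  have "((s n, \<phi> (s n)), cost u \<phi> (s n) T) \<in> G" for n
    by (rule backward_limit_interior[OF tr _ _ _ near])
      (use s[of n] a in auto)
  then show ?thesis
    using closed_sequentially[OF G_closed, of "\<lambda>n. ((s n, \<phi> (s n)), cost u \<phi> (s n) T)"]
      tendsto_Pair[OF tendsto_Pair[OF lim p] c] by blast
qed

text \<open>Three phases: a constant control until the time \<open>s0\<close> of a nearby graph
  point, the control of \<open>forward_viability\<close> until \<open>T - \<eta>\<close>, and a
  constant control until \<open>T\<close>. The outer phases last at most \<eta>, so they change
  state and cost by O(\<eta>).\<close>

lemma forward_approximation:
  assumes t0: "0 \<le> t0" "t0 < T" and e: "0 < e"
    and near: "\<And>e. 0 < e \<Longrightarrow> \<exists>s xk yk. ((s, xk), yk) \<in> G \<and> 0 < s \<and> t0 \<le> s \<and> s < t0 + e \<and>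
      norm (xk - x) < e \<and> norm (yk - y) < e"
  shows "\<exists>u \<phi>. traj t0 T u \<phi> \<and> \<phi> t0 = x \<and> (\<exists>p\<in>G. dist p ((T, \<phi> T), y - cost u \<phi> t0 T) < e)"
proof -
  note nn = constants_nonneg
  obtain w where w: "w \<in> U" using U_ne by blast
  \<comment> \<open>The square is for the state mismatch at \<open>s0\<close>, the 2 for the
    mismatch of \<open>y\<close> and the discretization error.\<close>
  define Q where "Q = exp (3 * K * T) * ((Mf + 1)\<^sup>2 + 2)"
  \<comment> \<open>Time and state move in the last phase, and both outer phases contribute
    cost.\<close>
  define R where "R = 1 + Mf + 2 * mL"
  have Q: "0 \<le> Q" unfolding Q_def by simp
  have R: "0 < R" unfolding R_def using nn by simp
  \<comment> \<open>One third of \<open>T - t0\<close> leaves room for the middle phase, the bound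
    with \<open>Kf\<close> lets each outer phase be a single extension, and the last two bounds
    split \<open>e\<close> evenly between the steering error and the outer phases.\<close>
  define \<eta> where "\<eta> = min (min ((T - t0) / 3) (1 / (2 * (Kf + 1)))) (min ((e / 2) / (Q + 1)) ((e / 2) / R))"
  have "0 < \<eta>" unfolding \<eta>_def using t0 e Q R nn by auto
  moreover have "\<eta> \<le> (T - t0) / 3" "\<eta> \<le> 1 / (2 * (Kf + 1))" "\<eta> \<le> (e / 2) / (Q + 1)" "\<eta> \<le> (e / 2) / R"
    unfolding \<eta>_def min_le_iff_disj by (simp_all only: order_refl simp_thms)
  ultimately have \<eta>: "0 < \<eta>" "\<eta> \<le> (T - t0) / 3" "\<eta> \<le> 1 / (2 * (Kf + 1))"
    "\<eta> \<le> (e / 2) / (Q + 1)" "\<eta> \<le> (e / 2) / R"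
    by blast+
  have \<eta>R: "R * \<eta> \<le> e / 2" using \<eta>(5) R by (simp add: field_simps)
  have \<eta>K: "\<eta> * Kf \<le> 1/2"
  proof -
    have "\<eta> * Kf \<le> (1 / (2 * (Kf + 1))) * Kf" using \<eta>(3) nn by (intro mult_right_mono) auto
    also have "\<dots> \<le> 1/2" using nn by (simp add: field_simps)
    finally show ?thesis .
  qed
  have short: "(b' - b) * Kf \<le> 1/2" if "b' - b \<le> \<eta>" for b b'
    using mult_right_mono[OF that nn(1)] \<eta>K by linarith
  obtain s0 xk yk where k: "((s0, xk), yk) \<in> G" "0 < s0" "t0 \<le> s0" "s0 < t0 + \<eta>"
      "norm (xk - x) < \<eta>" "norm (yk - y) < \<eta>"
    using near[OF \<eta>(1)] by blast
  define s1 where "s1 = T - \<eta>"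
  have s: "s0 \<le> s1" "s1 < T" unfolding s1_def using k \<eta> by auto
  \<comment> \<open>A trajectory over one instant, as a seed for \<open>traj_extend\<close>.\<close>
  have tr00: "traj t0 t0 (\<lambda>_. w) (\<lambda>_. x)"
    unfolding traj_def using w has_integral_refl(2) by auto
  obtain \<phi>1 where tr1: "traj t0 s0 (\<lambda>r. if r \<in> {t0..t0} then w else w) \<phi>1" and "\<And>r. r \<in> {t0..t0} \<Longrightarrow> \<phi>1 r = x"
    by (rule traj_extend[OF tr00 order_refl k(3) short w]) (use k in auto)
  then have \<phi>1: "\<phi>1 t0 = x" by simp
  obtain u2 \<phi>2 p where tr2: "traj t0 s1 u2 \<phi>2" and \<phi>2: "\<forall>r\<in>{t0..s0}. \<phi>2 r = \<phi>1 r"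
    and p: "p \<in> G" "wd2 1 ((s1, \<phi>2 s1), y - cost u2 \<phi>2 s0 s1) p
      \<le> exp (3 * K * (s1 - s0)) * ((norm (\<phi>1 s0 - xk))\<^sup>2 + (norm (y - yk))\<^sup>2 + \<eta>\<^sup>2)"
    using forward_viability[OF tr1 k(2,3) s k(1), of "\<eta>\<^sup>2" y] \<eta>(1)
    unfolding zero_less_power2 by blast
  define u where "u = (\<lambda>r. if r \<in> {t0..s1} then u2 r else w)"
  obtain \<phi> where tr: "traj t0 T u \<phi>" and \<phi>: "\<And>r. r \<in> {t0..s1} \<Longrightarrow> \<phi> r = \<phi>2 r"
    unfolding u_def using traj_extend[OF tr2 _ _ _ w, of T] short[of T s1] s k by (auto simp: s1_def)
  have "\<phi> t0 = x" using \<phi> \<phi>2 \<phi>1 k s by auto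
  have "norm (\<phi>1 s0 - \<phi>1 t0) \<le> Mf * (s0 - t0)"
    by (rule traj_lipschitz[OF tr1]) (use k in auto)
  also have "\<dots> \<le> Mf * \<eta>" using k nn by (intro mult_left_mono) auto
  finally have "norm (\<phi>1 s0 - xk) \<le> (Mf + 1) * \<eta>"
    using k(5) \<phi>1 norm_triangle_ineq4[of "\<phi>1 s0 - x" "xk - x"] by (simp add: algebra_simps)
  then have 1: "(norm (\<phi>1 s0 - xk))\<^sup>2 \<le> ((Mf + 1) * \<eta>)\<^sup>2" by (intro power_mono) auto
  have 2: "(norm (y - yk))\<^sup>2 \<le> \<eta>\<^sup>2"
    using k(6) by (intro power_mono) (auto simp: norm_minus_commute)
  have "(dist ((s1, \<phi>2 s1), y - cost u2 \<phi>2 s0 s1) p)\<^sup>2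
      \<le> exp (3 * K * (s1 - s0)) * ((norm (\<phi>1 s0 - xk))\<^sup>2 + (norm (y - yk))\<^sup>2 + \<eta>\<^sup>2)"
    using p(2) by (simp add: wd2_one)
  also have "\<dots> \<le> exp (3 * K * T) * (((Mf + 1) * \<eta>)\<^sup>2 + \<eta>\<^sup>2 + \<eta>\<^sup>2)"
    using 1 2 k s K_nonneg by (intro mult_mono add_mono) (auto intro!: mult_left_mono)
  also have "\<dots> = Q * \<eta>\<^sup>2" unfolding Q_def power_mult_distrib by (simp add: algebra_simps)
  also have "\<dots> < (e / 2)\<^sup>2" by (rule quadratic_small[OF Q \<eta>(1,4)])
  finally have d1: "dist ((s1, \<phi>2 s1), y - cost u2 \<phi>2 s0 s1) p < e / 2"
    by (rule power2_less_imp_less) (use e in simp)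
  have "cost u \<phi> s0 s1 = cost u2 \<phi>2 s0 s1"
    by (rule cost_cong) (use \<phi> k in \<open>auto simp: u_def\<close>)
  then have "cost u \<phi> t0 T = cost u \<phi> t0 s0 + cost u2 \<phi>2 s0 s1 + cost u \<phi> s1 T"
    using cost_combine[OF tr, of t0 s0 s1] cost_combine[OF tr, of t0 s1 T] k s by simp
  then have c: "(y - cost u \<phi> t0 T) - (y - cost u2 \<phi>2 s0 s1) = - (cost u \<phi> t0 s0 + cost u \<phi> s1 T)"
    by simp
  have "norm (cost u \<phi> t0 s0) \<le> mL * (s0 - t0)" by (rule cost_bound[OF tr]) (use k s in auto)
  also have "\<dots> \<le> mL * \<eta>" using k nn by (intro mult_left_mono) auto
  finally have c1: "norm (cost u \<phi> t0 s0) \<le> mL * \<eta>" .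
  have c2: "norm (cost u \<phi> s1 T) \<le> mL * \<eta>"
    using cost_bound[OF tr, of s1 T] k s by (simp add: s1_def)
  have x1: "norm (\<phi> T - \<phi>2 s1) \<le> Mf * \<eta>"
    using traj_lipschitz[OF tr, of s1 T] k s \<phi>[of s1] by (simp add: s1_def)
  have "dist ((T, \<phi> T), y - cost u \<phi> t0 T) ((s1, \<phi>2 s1), y - cost u2 \<phi>2 s0 s1)
      = norm ((T - s1, \<phi> T - \<phi>2 s1), - (cost u \<phi> t0 s0 + cost u \<phi> s1 T))"
    unfolding dist_norm c[symmetric] by simp
  also have "\<dots> \<le> (norm (T - s1) + norm (\<phi> T - \<phi>2 s1)) + (norm (cost u \<phi> t0 s0) + norm (cost u \<phi> s1 T))"
    by (intro norm_Pair_le[THEN order_trans] add_mono norm_Pair_le)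
      (simp add: norm_triangle_ineq flip: minus_add_distrib)
  also have "\<dots> \<le> R * \<eta>"
    using c1 c2 x1 \<eta>(1) unfolding R_def by (simp add: s1_def algebra_simps)
  finally have "dist p ((T, \<phi> T), y - cost u \<phi> t0 T) < e"
    using d1 \<eta>R dist_triangle[of p "((T, \<phi> T), y - cost u \<phi> t0 T)" "((s1, \<phi>2 s1), y - cost u2 \<phi>2 s0 s1)"]
    by (simp add: dist_commute)
  then show ?thesis using tr \<open>\<phi> t0 = x\<close> p(1) by blast
qed

text \<open>Only end states and costs pass to the limit. They stay in a compact box, a limit point
  lies in \<open>G\<close> at time \<open>T\<close>, hence over some \<open>q \<in> P\<close>, and
  the costs along the subsequence tend to \<open>y - q\<close>.\<close>

lemma forward_limit:
  assumes t0: "0 \<le> t0" "t0 < T" and terminal: "\<And>x q. ((T, x), q) \<in> G \<Longrightarrow> q \<in> P"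
    and near: "\<And>e. 0 < e \<Longrightarrow> \<exists>s xk yk. ((s, xk), yk) \<in> G \<and> 0 < s \<and> t0 \<le> s \<and> s < t0 + e \<and>
      norm (xk - x) < e \<and> norm (yk - y) < e"
  shows "\<exists>q\<in>P. y - q \<in> closure {cost u \<phi> t0 T | u \<phi>. traj t0 T u \<phi> \<and> \<phi> t0 = x}"
proof -
  have "\<forall>n. \<exists>u \<phi> p. traj t0 T u \<phi> \<and> \<phi> t0 = x \<and> p \<in> G \<and>
      dist p ((T, \<phi> T), y - cost u \<phi> t0 T) < 1 / real (Suc n)"
    using forward_approximation[OF t0 _ near] by (simp add: Bex_def)
  then obtain u \<phi> p where tr: "\<And>n. traj t0 T (u n) (\<phi> n)" "\<And>n. \<phi> n t0 = x" and pG: "\<And>n. p n \<in> G"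
    and d: "\<And>n. dist (p n) ((T, \<phi> n T), y - cost (u n) (\<phi> n) t0 T) < 1 / real (Suc n)"
    by metis
  define z where "z n = ((T, \<phi> n T), y - cost (u n) (\<phi> n) t0 T)" for n
  define C where "C = ({T} \<times> cball x (Mf * (T - t0))) \<times> cball y (mL * (T - t0))"
  have "z n \<in> C" for n
    unfolding z_def C_def
    using traj_lipschitz[OF tr(1)[of n], of t0 T] cost_bound[OF tr(1)[of n], of t0 T] tr(2)[of n] t0
    by (auto simp: dist_norm norm_minus_commute)
  moreover have "compact C" unfolding C_def by (intro compact_Times) auto
  ultimately obtain l r where r: "strict_mono r" and lim: "(z \<circ> r) \<longlonglongrightarrow> l" and lC: "l \<in> C"
    unfolding compact_def by blast
  have "(\<lambda>n. dist (p n) (z n)) \<longlonglongrightarrow> 0"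
    by (rule tendsto_sandwich[OF _ _ tendsto_const lim_inverse_n'[THEN LIMSEQ_Suc]])
      (use d in \<open>auto simp: z_def simp del: of_nat_Suc intro!: always_eventually less_imp_le\<close>)
  then have "(\<lambda>n. dist ((p \<circ> r) n) ((z \<circ> r) n)) \<longlonglongrightarrow> 0"
    using LIMSEQ_subseq_LIMSEQ[OF _ r] by (force simp: o_def)
  then have "(\<lambda>n. (p \<circ> r) n - (z \<circ> r) n) \<longlonglongrightarrow> 0"
    unfolding dist_norm by (rule tendsto_norm_zero_cancel)
  with lim have "(p \<circ> r) \<longlonglongrightarrow> l" by (rule Lim_transform)
  then have "l \<in> G" using closed_sequentially[OF G_closed, of "p \<circ> r"] pG by auto
  moreover obtain x' q where l: "l = ((T, x'), q)" using lC unfolding C_def by auto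
  ultimately have "q \<in> P" using terminal by blast
  have "(\<lambda>n. snd ((z \<circ> r) n)) \<longlonglongrightarrow> snd l" by (rule tendsto_snd[OF lim])
  then have "(\<lambda>n. y - snd ((z \<circ> r) n)) \<longlonglongrightarrow> y - snd l" by (intro tendsto_diff tendsto_const)
  then have "(\<lambda>n. cost (u (r n)) (\<phi> (r n)) t0 T) \<longlonglongrightarrow> y - q"
    by (simp add: z_def l)
  moreover have "\<forall>n. cost (u (r n)) (\<phi> (r n)) t0 T \<in> {cost u \<phi> t0 T | u \<phi>. traj t0 T u \<phi> \<and> \<phi> t0 = x}"
    using tr by blast
  ultimately have "y - q \<in> closure {cost u \<phi> t0 T | u \<phi>. traj t0 T u \<phi> \<and> \<phi> t0 = x}"
    unfolding closure_sequential by (intro exI[of _ "\<lambda>n. cost (u (r n)) (\<phi> (r n)) t0 T"] conjI)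
  then show ?thesis using \<open>q \<in> P\<close> by blast
qed

end

section \<open>The set-valued return function\<close>

context moc
begin

text \<open>The minimum over the compact \<open>U\<close> defines a closed half-space containing all
  velocities, hence also the closure of their convex hull; it is attained there at the same
  velocity.\<close>

lemma FL_Inf_attained:
  obtains u0 where "u0 \<in> U"
    "Inf ((\<lambda>(a, b). inner v a + inner w b) ` FL f L U x) = inner v (f x u0) + inner w (L x u0)"
    "\<And>u. u \<in> U \<Longrightarrow> inner v (f x u0) + inner w (L x u0) \<le> inner v (f x u) + inner w (L x u)"
proof -
  have sub: "continuous_on U (\<lambda>u. (x, u))" "(\<lambda>u. (x, u)) ` U \<subseteq> UNIV \<times> U"
    by (auto intro!: continuous_intros)
  have "continuous_on U (\<lambda>u. f x u)"
    using continuous_on_compose2[OF f_cont sub] by simp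
  moreover have "continuous_on U (\<lambda>u. L x u)"
    using continuous_on_compose2[OF L_cont sub] by simp
  ultimately have "continuous_on U (\<lambda>u. inner v (f x u) + inner w (L x u))"
    by (intro continuous_intros)
  from continuous_attains_inf[OF U_compact U_ne this] obtain u0 where u0: "u0 \<in> U"
    "\<And>u. u \<in> U \<Longrightarrow> inner v (f x u0) + inner w (L x u0) \<le> inner v (f x u) + inner w (L x u)"
    by blast
  define m where "m = inner v (f x u0) + inner w (L x u0)"
  define S where "S = (\<lambda>u. (f x u, L x u)) ` U"
  have "S \<subseteq> {p. inner (v, w) p \<ge> m}" unfolding S_def m_def using u0 by auto
  then have "closure (convex hull S) \<subseteq> {p. inner (v, w) p \<ge> m}"
    by (intro closure_minimal hull_minimal convex_halfspace_ge closed_halfspace_ge)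
  then have ge: "m \<le> inner v a + inner w b" if "(a, b) \<in> FL f L U x" for a b
    using that unfolding FL_def S_def by auto
  have "(f x u0, L x u0) \<in> FL f L U x"
    unfolding FL_def by (rule subsetD[OF closure_subset], rule hull_inc) (use u0(1) in blast)
  then have "m \<in> (\<lambda>(a, b). inner v a + inner w b) ` FL f L U x"
    by (rule rev_image_eqI) (simp add: m_def)
  then have "Inf ((\<lambda>(a, b). inner v a + inner w b) ` FL f L U x) = m"
    by (rule cInf_eq_minimum) (use ge in auto)
  then show ?thesis using that u0 unfolding m_def by blast
qed

text \<open>\<open>controls\<close> asks for a control on all of \<open>{0..T}\<close>,
  \<open>traj\<close> only for one on \<open>{t..T}\<close>; a constant value from \<open>U\<close>
  fills in the earlier times.\<close>

lemma Yset_eq_traj_costs: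
  assumes t: "0 \<le> t" "t \<le> T"
  shows "Yset f L U T t x = {cost u \<phi> t T | u \<phi>. traj t T u \<phi> \<and> \<phi> t = x}"
proof (intro set_eqI iffI)
  fix y assume "y \<in> Yset f L U T t x"
  then obtain u \<phi> where u: "u \<in> controls T U" and tr: "is_traj f T t x u \<phi>"
    and y: "y = integral {t..T} (\<lambda>s. L (\<phi> s) (u s))"
    unfolding Yset_def by blast
  have "u \<in> borel_measurable (lebesgue_on {0..T})" using u by (simp add: controls_def)
  then have "u \<in> borel_measurable (lebesgue_on {t..T})"
    by (rule measurable_restrict_mono) (use t in simp)
  then have "traj t T u \<phi>"
    using u tr t unfolding traj_def is_traj_def controls_def by auto
  moreover have "\<phi> t = x" using tr by (simp add: is_traj_def)
  ultimately show "y \<in> {cost u \<phi> t T | u \<phi>. traj t T u \<phi> \<and> \<phi> t = x}"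
    using y unfolding cost_def by blast
next
  fix y assume "y \<in> {cost u \<phi> t T | u \<phi>. traj t T u \<phi> \<and> \<phi> t = x}"
  then obtain u \<phi> where tr: "traj t T u \<phi>" and x: "\<phi> t = x" and y: "y = cost u \<phi> t T" by blast
  obtain w where w: "w \<in> U" using U_ne by blast
  define u' where "u' = (\<lambda>r. if r \<in> {t..T} then u r else w)"
  have "u \<in> borel_measurable (lebesgue_on {t..T})" using tr by (simp add: traj_def)
  then have "u' \<in> borel_measurable lebesgue"
    unfolding u'_def using measurable_restrict_space_iff[of "{t..T}" lebesgue w borel u] by simp
  then have "u' \<in> borel_measurable (lebesgue_on {0..T})" by (rule measurable_restrict_space1)
  moreover have uU: "u' r \<in> U" for r unfolding u'_def using traj_control[OF tr] w by auto
  moreover have "bounded (u' ` {0..T})"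
    by (rule bounded_subset[OF compact_imp_bounded[OF U_compact]]) (use uU in auto)
  ultimately have "u' \<in> controls T U" unfolding controls_def by blast
  moreover have "is_traj f T t x u' \<phi>"
    unfolding is_traj_def
  proof (intro conjI ballI)
    fix s assume s: "s \<in> {t..T}"
    show "((\<lambda>r. f (\<phi> r) (u' r)) has_integral (\<phi> s - x)) {t..s}"
      by (rule has_integral_eq[OF _ traj_increment[OF tr, of t s, unfolded x]])
        (use s in \<open>auto simp: u'_def\<close>)
  qed (rule x)
  moreover have "y = cost u' \<phi> t T"
    unfolding y by (rule cost_cong) (auto simp: u'_def)
  ultimately show "y \<in> Yset f L U T t x" unfolding Yset_def cost_def by blast
qed

lemma Yset_bounded:
  assumes t: "0 \<le> t" "t \<le> T"
  shows "bounded (Yset f L U T t x)"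
  unfolding Yset_eq_traj_costs[OF assms] bounded_iff
  using cost_bound t by (intro exI[of _ "mL * (T - t)"]) blast

lemma Yset_terminal: "0 \<le> T \<Longrightarrow> Yset f L U T T x = {0}"
proof -
  assume T: "0 \<le> T"
  obtain w where w: "w \<in> U" using U_ne by blast
  have "traj T T (\<lambda>_. w) (\<lambda>_. x)"
    unfolding traj_def using w has_integral_refl(2) by auto
  moreover have "cost u \<phi> T T = 0" for u \<phi> by (simp add: cost_def)
  ultimately show ?thesis unfolding Yset_eq_traj_costs[OF T order_refl] by fastforce
qed

end

section \<open>Closed graphs, limit points and normals of the graph\<close>

lemma gph_closed:
  fixes F :: "real \<Rightarrow> 'n::euclidean_space \<Rightarrow> 'p::euclidean_space set"
  assumes "osc_on T F" shows "closed (gph T F)"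
  unfolding closed_sequential_limits
proof (intro allI impI, elim conjE)
  fix p l assume p: "\<forall>n. p n \<in> gph T F" and lim: "p \<longlonglongrightarrow> l"
  obtain t x y where l: "l = ((t, x), y)" by (metis surj_pair)
  have lims: "(\<lambda>n. fst (fst (p n))) \<longlonglongrightarrow> t" "(\<lambda>n. snd (fst (p n))) \<longlonglongrightarrow> x" "(\<lambda>n. snd (p n)) \<longlonglongrightarrow> y"
    using tendsto_fst[OF tendsto_fst[OF lim]] tendsto_snd[OF tendsto_fst[OF lim]] tendsto_snd[OF lim] l
    by auto
  have mem: "fst (fst (p n)) \<in> {0..T}" "snd (p n) \<in> F (fst (fst (p n))) (snd (fst (p n)))" for n
    using p[rule_format, of n] unfolding gph_def by auto
  have t: "t \<in> {0..T}"
    by (rule closed_sequentially[OF closed_atLeastAtMost mem(1) lims(1)])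
  moreover have "y \<in> lim_sup_on {0..T} F t x"
    unfolding lim_sup_on_def mem_Collect_eq
    by (rule exI[of _ "\<lambda>n. fst (fst (p n))"], rule exI[of _ "\<lambda>n. snd (fst (p n))"],
        rule exI[of _ "\<lambda>n. snd (p n)"]) (use mem lims in auto)
  ultimately show "l \<in> gph T F"
    using assms unfolding osc_on_def gph_def l by blast
qed

lemma lim_sup_on_near:
  assumes "y \<in> lim_sup_on D F t x" "0 < e"
  obtains s x' y' where "s \<in> D" "y' \<in> F s x'" "\<bar>s - t\<bar> < e" "norm (x' - x) < e" "norm (y' - y) < e"
proof -
  obtain tk xk yk where *: "\<forall>k. tk k \<in> D \<and> yk k \<in> F (tk k) (xk k)"
    "tk \<longlonglongrightarrow> t" "xk \<longlonglongrightarrow> x" "yk \<longlonglongrightarrow> y"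
    using assms(1) unfolding lim_sup_on_def by blast
  have "\<forall>\<^sub>F k in sequentially. dist (tk k) t < e \<and> dist (xk k) x < e \<and> dist (yk k) y < e"
    using *(2-4) assms(2) by (intro eventually_conj tendstoD)
  then obtain k where "dist (tk k) t < e" "dist (xk k) x < e" "dist (yk k) y < e"
    by (auto dest: eventually_happens)
  then show ?thesis using that[of "tk k" "yk k" "xk k"] * by (simp add: dist_norm)
qed

text \<open>The graph is invariant under translation by \<open>P\<close>, so hypothesis (2), which only speaks
  about \<open>y \<in> W t x\<close>, controls the normals at every point of the graph of \<open>up W P\<close>.\<close>

lemma prox_normal_up:
  assumes P: "convex P" "cone P" "0 \<in> P" and q: "q \<in> P"
    and v: "v \<in> prox_normal (gph T (up W P)) (z, w + q)"
  shows "v \<in> prox_normal (gph T (up W P)) (z, w)"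
proof -
  obtain M where M: "M > 0" "\<And>p. p \<in> gph T (up W P) \<Longrightarrow> inner v (p - (z, w + q)) \<le> M * (norm (p - (z, w + q)))\<^sup>2"
    using v unfolding prox_normal_def by blast
  have "inner v (p - (z, w)) \<le> M * (norm (p - (z, w)))\<^sup>2" if p: "p \<in> gph T (up W P)" for p
  proof -
    obtain t x y where pe: "p = ((t, x), y)" by (metis surj_pair)
    then obtain w' q' where "t \<in> {0..T}" "w' \<in> W t x" "q' \<in> P" "y = w' + q'"
      using p unfolding gph_def up_def by auto
    then have "((t, x), y + q) \<in> gph T (up W P)"
      using convex_cone_add[OF P(1,2) _ q] unfolding gph_def up_def by (auto simp: add.assoc)
    from M(2)[OF this] show ?thesis
      by (simp add: pe)
  qed
  then show ?thesis using M(1) unfolding prox_normal_def by blast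
qed

section \<open>Comparison of \<open>W\<close> with the efficient values\<close>

theorem theorem8p3:
  fixes T :: real
    and U :: "'m::euclidean_space set"
    and f :: "'n::euclidean_space \<Rightarrow> 'm \<Rightarrow> 'n"
    and L :: "'n \<Rightarrow> 'm \<Rightarrow> 'p::euclidean_space"
    and P :: "'p set"
    and W :: "real \<Rightarrow> 'n \<Rightarrow> 'p set"
    and Kf Mf kL mL :: real
  assumes T_pos: "T > 0"
    and U_ne: "U \<noteq> {}" and U_compact: "compact U"
    and f_cont: "continuous_on (UNIV \<times> U) (\<lambda>(x, u). f x u)"
    and Kf_pos: "Kf > 0" and Mf_pos: "Mf > 0"
    and f_lip: "\<forall>x1 x2. \<forall>u\<in>U. norm (f x1 u - f x2 u) \<le> Kf * norm (x1 - x2)"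
    and f_bd: "\<forall>x. \<forall>u\<in>U. norm (f x u) \<le> Mf"
    and L_cont: "continuous_on (UNIV \<times> U) (\<lambda>(x, u). L x u)"
    and L_bd: "\<forall>x. \<forall>u\<in>U. norm (L x u) \<le> mL"
    and L_lip: "\<forall>x1 x2. \<forall>u\<in>U. norm (L x1 u - L x2 u) \<le> kL * norm (x1 - x2)"
    and P_closed: "closed P" and P_convex: "convex P" and P_cone: "cone P"
    and P_zero: "0 \<in> P" and P_pointed: "P \<inter> uminus ` P = {0}"
    and P_int: "interior P \<noteq> {}"
    and H1: "osc_on T (up W P)"
    and H2: "\<forall>t\<in>{0<..<T}. \<forall>x. \<forall>y\<in>W t x. \<forall>w.
              coderiv T (up W P) t x y w \<noteq> {} \<longrightarrow>
              (\<forall>(xi, v)\<in>coderiv T (up W P) t x y w.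
                 xi + Inf ((\<lambda>(a, b). inner v a + inner w b) ` FL f L U x) = 0)"
    and H3: "\<forall>x. up W P 0 x \<subseteq> lim_sup_on {0<..T} (up W P) 0 x
               \<and> up W P T x \<subseteq> lim_sup_on {0..<T} (up W P) T x"
    and H4: "\<forall>x. W T x = {0}"
  shows "\<forall>t\<in>{0..T}. \<forall>x. Vmap f L U T P t x \<subseteq> up W P t x
            \<and> W t x \<subseteq> up (Vmap f L U T P) P t x"
proof -
  interpret moc U f L Kf Mf kL mL
    using U_ne U_compact f_cont f_lip f_bd L_cont L_bd L_lip by unfold_locales auto
  define G where "G = gph T (up W P)"
  have ham: "0 \<le> xi + inner v (f x u) - inner \<eta> (L x u)"
       "\<exists>u\<in>U. xi + inner v (f x u) - inner \<eta> (L x u) \<le> 0"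
    if g: "((t, x), y) \<in> G" and t: "0 < t" "t < T"
      and n: "((xi, v), \<eta>) \<in> prox_normal G ((t, x), y)" and u: "u \<in> U"
    for t x y xi v \<eta> u
  proof -
    obtain w q where w: "w \<in> W t x" "q \<in> P" "y = w + q"
      using g unfolding G_def gph_def up_def by auto
    have "((xi, v), \<eta>) \<in> prox_normal G ((t, x), w)"
      using prox_normal_up[OF P_convex P_cone P_zero w(2), of _ T W "(t, x)" w] n w(3) unfolding G_def by simp
    \<comment> \<open>\<open>coderiv\<close> pairs \<open>w\<close> with a normal whose last
      component is \<open>- w\<close>, so \<eta> enters as \<open>- \<eta>\<close>.\<close>
    then have c: "(xi, v) \<in> coderiv T (up W P) t x w (- \<eta>)"
      unfolding coderiv_def G_def by simp
    obtain u0 where u0: "u0 \<in> U"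
      "Inf ((\<lambda>(a, b). inner v a + inner (- \<eta>) b) ` FL f L U x) = inner v (f x u0) + inner (- \<eta>) (L x u0)"
      "\<And>u. u \<in> U \<Longrightarrow> inner v (f x u0) + inner (- \<eta>) (L x u0) \<le> inner v (f x u) + inner (- \<eta>) (L x u)"
      using FL_Inf_attained[of v "- \<eta>" x] by metis
    have "t \<in> {0<..<T}" using t by simp
    then have "xi + Inf ((\<lambda>(a, b). inner v a + inner (- \<eta>) b) ` FL f L U x) = 0"
      using H2 w(1) c by blast
    then have "xi + inner v (f x u0) - inner \<eta> (L x u0) = 0" using u0(2) by simp
    then show "0 \<le> xi + inner v (f x u) - inner \<eta> (L x u)"
       "\<exists>u\<in>U. xi + inner v (f x u) - inner \<eta> (L x u) \<le> 0"
      using u0(3)[OF u] by (simp, intro bexI[OF _ u0(1)], simp)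
  qed
  interpret moc_graph U f L Kf Mf kL mL T G
  proof
    show "closed G" unfolding G_def by (rule gph_closed[OF H1])
    show "\<exists>w\<in>U. xi + inner v (f x w) - inner \<eta> (L x w) \<le> 0"
      if "((t, x), y) \<in> G" "0 < t" "t < T" "((xi, v), \<eta>) \<in> prox_normal G ((t, x), y)"
      for t x y xi v \<eta>
      using ham(2)[OF that] U_ne by blast
  qed (use T_pos ham(1) in auto)
  have upT: "up W P T x = P" for x unfolding up_def using H4 by auto
  have W_up: "W t x \<subseteq> up W P t x" for t x unfolding up_def using P_zero by force
  have lower: "closure (Yset f L U T t x) \<subseteq> up W P t x" if t: "t \<in> {0..T}" for t x
  proof (cases "t = T")
    case True
    then show ?thesis using Yset_terminal[of T x] T_pos upT P_zero by simp
  next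
    case False
    \<comment> \<open>The section of \<open>G\<close> is closed, so it is enough to place
      \<open>Yset\<close> itself inside it.\<close>
    have "closed {y. ((t, x), y) \<in> G}"
      using closed_vimage[OF G_closed, of "\<lambda>y. ((t, x), y)"]
      by (simp add: vimage_def continuous_intros)
    moreover have "Yset f L U T t x \<subseteq> {y. ((t, x), y) \<in> G}"
    proof
      fix y assume "y \<in> Yset f L U T t x"
      then obtain u \<phi> where tr: "traj t T u \<phi>" "\<phi> t = x" "y = cost u \<phi> t T"
        using Yset_eq_traj_costs t by auto
      have "((t, \<phi> t), cost u \<phi> t T) \<in> G"
      proof (rule backward_limit[OF tr(1)])
        fix e :: real assume e: "0 < e"
        \<comment> \<open>At time \<open>T\<close> the values form \<open>P\<close>, which contains
          0; \<open>H3\<close> makes this point a limit of graph points at earlier times.\<close>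
        have "0 \<in> lim_sup_on {0..<T} (up W P) T (\<phi> T)" using H3 upT P_zero by blast
        then obtain s x' y' where "s \<in> {0..<T}" "y' \<in> up W P s x'" "\<bar>s - T\<bar> < e"
            "norm (x' - \<phi> T) < e" "norm (y' - 0) < e"
          using e by (rule lim_sup_on_near)
        then show "\<exists>s x y. ((s, x), y) \<in> G \<and> T - e < s \<and> s < T \<and> norm (x - \<phi> T) < e \<and> norm y < e"
          by (intro exI[of _ s] exI[of _ x'] exI[of _ y']) (auto simp: G_def gph_def)
      qed (use t False in auto)
      then show "y \<in> {y. ((t, x), y) \<in> G}" using tr by simp
    qed
    ultimately have "closure (Yset f L U T t x) \<subseteq> {y. ((t, x), y) \<in> G}" by (intro closure_minimal)
    then show ?thesis unfolding G_def gph_def by auto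
  qed
  have upper: "\<exists>q\<in>P. y - q \<in> closure (Yset f L U T t x)" if t: "t \<in> {0..T}" and y: "y \<in> W t x" for t x y
  proof (cases "t = T")
    case True
    then show ?thesis using Yset_terminal[of T x] T_pos H4 y P_zero by force
  next
    case False
    \<comment> \<open>For \<open>t = 0\<close> the starting points at positive times come from
      \<open>H3\<close>; for positive \<open>t\<close> the point itself will do.\<close>
    have near: "\<exists>s xk yk. ((s, xk), yk) \<in> G \<and> 0 < s \<and> t \<le> s \<and> s < t + e \<and>
      norm (xk - x) < e \<and> norm (yk - y) < e" if e: "0 < e" for e
    proof (cases "t = 0")
      case True
      have "y \<in> lim_sup_on {0<..T} (up W P) 0 x" using H3 W_up y True by blast
      then obtain s x' y' where "s \<in> {0<..T}" "y' \<in> up W P s x'" "\<bar>s - 0\<bar> < e"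
          "norm (x' - x) < e" "norm (y' - y) < e"
        using e by (rule lim_sup_on_near)
      then show ?thesis
        using True by (intro exI[of _ s] exI[of _ x'] exI[of _ y']) (auto simp: G_def gph_def)
    next
      case False
      then show ?thesis
        using t y W_up e by (intro exI[of _ t] exI[of _ x] exI[of _ y]) (auto simp: G_def gph_def)
    qed
    have "q \<in> P" if "((T, x'), q) \<in> G" for x' q
      using that upT unfolding G_def gph_def by auto
    then show ?thesis
      using forward_limit[OF _ _ _ near, of P] t False Yset_eq_traj_costs[of t T x] by auto
  qed
  show ?thesis
  proof (intro ballI allI conjI)
    fix t x assume t: "t \<in> {0..T}"
    show "Vmap f L U T P t x \<subseteq> up W P t x"
      using lower[OF t] unfolding Vmap_def efficient_def by blast
    show "W t x \<subseteq> up (Vmap f L U T P) P t x"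
    proof
      fix y assume "y \<in> W t x"
      then obtain q where q: "q \<in> P" "y - q \<in> closure (Yset f L U T t x)" using upper[OF t] by blast
      \<comment> \<open>Compactness gives an efficient point below \<open>y - q\<close>; the two
        differences add up within \<open>P\<close>.\<close>
      have "compact (closure (Yset f L U T t x))"
        using Yset_bounded[of t T x] t by (simp add: compact_closure)
      then obtain e q' where e: "e \<in> Vmap f L U T P t x" "q' \<in> P" "y - q = e + q'"
        using compact_efficient_domination[OF _ P_closed P_convex P_cone P_zero P_pointed q(2)]
        unfolding Vmap_def by blast
      then have "y = e + (q' + q)" by (metis add.assoc diff_add_cancel)
      then show "y \<in> up (Vmap f L U T P) P t x"
        unfolding up_def using e convex_cone_add[OF P_convex P_cone e(2) q(1)] by blast
    qed
  qed
qed

end
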